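(* Let $(X_i,Z_i)_{i\ge1}$ be i.i.d. with joint distribution $P_{XZ}$ on finite alphabets $\mathcal{X}\times\mathcal{Z}$, and let $D:\mathcal{X}\times\mathcal{X}\to[0,d_{\max}]$, $d_{\max}<\infty$. The rate-distortion-perception function with respect to the empirical perceptual constraint is \[ R^{(e)}(\Delta,\Pi)=\inf_{\substack{P_{Y|XZ}:\ \mathbb{E}[D(X,Y)]\le\Delta\\ d_{\mathrm{TV}}(P_X,P_Y)\le\Pi}} I(X;Y|Z), \] where the infimum is over conditional distributions of $Y\in\mathcal{X}$ given $(X,Z)\sim P_{XZ}$.
   Context: $d_{\mathrm{TV}}(P,Q)=\sup_A|P(A)-Q(A)|$; $\hat P_{x^n}(x)=\frac1n\sum_{i=1}^n\mathbf 1\{x_i=x\}$; $D(x^n,y^n)=\frac1n\sum_iD(x_i,y_i)$; $[m]=\{1,\dots,\lfloor m\rfloor\}$. An $(n,2^{nR},2^{nR_0})$ code consists of a (possibly stochastic) encoder $f_n:\mathcal{X}^n\times\mathcal{Z}^n\times[2^{nR_0}]\to[2^{nR}]$ and a (possibly stochastic) decoder $g_n:[2^{nR}]\times\mathcal{Z}^n\times[2^{nR_0}]\to\mathcal{X}^n$, with common randomness $K$ uniform on $[2^{nR_0}]$ independent of $(X^n,Z^n)$ and output $Y^n=g_n(f_n(X^n,Z^n,K),Z^n,K)$. $(R,R_0,\Delta,\Pi)$ is achievable with respect to empirical perception if for every $\epsilon>0$ there is a sequence of $(n,2^{n(R+\epsilon)},2^{n(R_0+\epsilon)})$ codes with $\mathbb{E}[D(X^n,Y^n)]\le\Delta+\epsilon$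 and $\mathbb{E}[d_{\mathrm{TV}}(\hat P_{X^n},\hat P_{Y^n})]\le\Pi+\epsilon$. $R^{(e)}(\Delta,\Pi)$ denotes the infimum of rates $R$ such that $(R,R_0,\Delta,\Pi)$ is achievable with respect to empirical perception for some $R_0\ge0$. *)

theory Defs
  imports "HOL-Probability.Probability_Mass_Function" "HOL-Library.Extended_Real"
begin

definition idx_set :: "real \<Rightarrow> nat set" where
  "idx_set m = {1..nat \<lfloor>m\<rfloor>}"

fun iid_pmf :: "nat \<Rightarrow> 'a pmf \<Rightarrow> 'a list pmf" where
  "iid_pmf 0 P = return_pmf []"
| "iid_pmf (Suc n) P = bind_pmf P (\<lambda>a. bind_pmf (iid_pmf n P) (\<lambda>as. return_pmf (a # as)))"

definition emp :: "'a list \<Rightarrow> 'a \<Rightarrow> real" where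
  "emp xs a = real (length (filter (\<lambda>b. b = a) xs)) / real (length xs)"

definition dtv :: "('a::finite \<Rightarrow> real) \<Rightarrow> ('a \<Rightarrow> real) \<Rightarrow> real" where
  "dtv p q = Sup ((\<lambda>A. \<bar>(\<Sum>a\<in>A. p a) - (\<Sum>a\<in>A. q a)\<bar>) ` UNIV)"

definition dist_n :: "('x \<Rightarrow> 'x \<Rightarrow> real) \<Rightarrow> 'x list \<Rightarrow> 'x list \<Rightarrow> real" where
  "dist_n D xs ys = (1 / real (length xs)) * (\<Sum>i<length xs. D (xs ! i) (ys ! i))"

text \<open>Joint law of (X^n, Y^n) for a code: stochastic encoder f, stochastic decoder g,
  common randomness K uniform on [M0].\<close>
definition code_joint ::
  "nat \<Rightarrow> ('x \<times> 'z) pmf \<Rightarrow> nat \<Rightarrow>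
   ('x list \<Rightarrow> 'z list \<Rightarrow> nat \<Rightarrow> nat pmf) \<Rightarrow>
   (nat \<Rightarrow> 'z list \<Rightarrow> nat \<Rightarrow> 'x list pmf) \<Rightarrow> ('x list \<times> 'x list) pmf" where
  "code_joint n P M0 f g =
     bind_pmf (iid_pmf n P) (\<lambda>xz.
     bind_pmf (pmf_of_set {1..M0}) (\<lambda>k.
     bind_pmf (f (map fst xz) (map snd xz) k) (\<lambda>m.
     bind_pmf (g m (map snd xz) k) (\<lambda>ys.
     return_pmf (map fst xz, ys)))))"

text \<open>(f,g) is an (n, 2^{nR}, 2^{nR0}) code (rates R, R0 given as reals; the message
  and key sets are [2^{nR}] and [2^{nR0}]).\<close>
definition is_code ::
  "nat \<Rightarrow> real \<Rightarrow> real \<Rightarrow>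
   ('x list \<Rightarrow> 'z list \<Rightarrow> nat \<Rightarrow> nat pmf) \<Rightarrow>
   (nat \<Rightarrow> 'z list \<Rightarrow> nat \<Rightarrow> 'x list pmf) \<Rightarrow> bool" where
  "is_code n R R0 f g \<longleftrightarrow>
     (\<forall>xs zs k. set_pmf (f xs zs k) \<subseteq> idx_set (2 powr (real n * R))) \<and>
     (\<forall>m zs k. set_pmf (g m zs k) \<subseteq> {ys. length ys = n})"

text \<open>Achievability w.r.t. empirical perception; "a sequence of codes" is read as:
  a code for every sufficiently large block length n.\<close>
definition achievable_e ::
  "('x::finite \<times> 'z) pmf \<Rightarrow> ('x \<Rightarrow> 'x \<Rightarrow> real) \<Rightarrow> real \<Rightarrow> real \<Rightarrow> real \<Rightarrow> real \<Rightarrow> bool" where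
  "achievable_e P D R R0 Dc Pc \<longleftrightarrow>
     (\<forall>\<epsilon>>0. \<exists>N. \<forall>n\<ge>N. \<exists>f g.
        is_code n (R + \<epsilon>) (R0 + \<epsilon>) f g \<and>
        (let J = code_joint n P (nat \<lfloor>2 powr (real n * (R0 + \<epsilon>))\<rfloor>) f g in
           measure_pmf.expectation J (\<lambda>(xs, ys). dist_n D xs ys) \<le> Dc + \<epsilon> \<and>
           measure_pmf.expectation J (\<lambda>(xs, ys). dtv (emp xs) (emp ys)) \<le> Pc + \<epsilon>))"

text \<open>Operational RDP function (infimum in the extended reals; +\<infinity> if no rate works).\<close>
definition R_e ::
  "('x::finite \<times> 'z) pmf \<Rightarrow> ('x \<Rightarrow> 'x \<Rightarrow> real) \<Rightarrow> real \<Rightarrow> real \<Rightarrow> ereal" where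
  "R_e P D Dc Pc = Inf (ereal ` {R. \<exists>R0\<ge>0. achievable_e P D R R0 Dc Pc})"

definition PX :: "('x \<times> 'z::finite) pmf \<Rightarrow> 'x \<Rightarrow> real" where
  "PX P x = (\<Sum>z\<in>UNIV. pmf P (x, z))"

definition PY :: "('x::finite \<times> 'z::finite) pmf \<Rightarrow> ('x \<Rightarrow> 'z \<Rightarrow> 'x pmf) \<Rightarrow> 'x \<Rightarrow> real" where
  "PY P W y = (\<Sum>x\<in>UNIV. \<Sum>z\<in>UNIV. pmf P (x, z) * pmf (W x z) y)"

definition exp_dist :: "('x::finite \<times> 'z::finite) pmf \<Rightarrow> ('x \<Rightarrow> 'z \<Rightarrow> 'x pmf) \<Rightarrow> ('x \<Rightarrow> 'x \<Rightarrow> real) \<Rightarrow> real" where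
  "exp_dist P W D = (\<Sum>x\<in>UNIV. \<Sum>z\<in>UNIV. \<Sum>y\<in>UNIV. pmf P (x, z) * pmf (W x z) y * D x y)"

definition cond_mi :: "('x::finite \<times> 'z::finite) pmf \<Rightarrow> ('x \<Rightarrow> 'z \<Rightarrow> 'x pmf) \<Rightarrow> real" where
  "cond_mi P W = (\<Sum>x\<in>UNIV. \<Sum>z\<in>UNIV. \<Sum>y\<in>UNIV.
     (let pxzy = pmf P (x, z) * pmf (W x z) y;
          pz = (\<Sum>x'\<in>UNIV. pmf P (x', z));
          pxz = pmf P (x, z);
          pzy = (\<Sum>x'\<in>UNIV. pmf P (x', z) * pmf (W x' z) y)
      in if pxzy = 0 then 0 else pxzy * log 2 (pxzy * pz / (pxz * pzy))))"

text \<open>Informational RDP function (infimum in the extended reals; +\<infinity> if infeasible).\<close>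
definition R_info ::
  "('x::finite \<times> 'z::finite) pmf \<Rightarrow> ('x \<Rightarrow> 'x \<Rightarrow> real) \<Rightarrow> real \<Rightarrow> real \<Rightarrow> ereal" where
  "R_info P D Dc Pc = Inf ((\<lambda>W. ereal (cond_mi P W)) `
      {W. exp_dist P W D \<le> Dc \<and> dtv (PX P) (PY P W) \<le> Pc})"

end

theory Submission
  imports Defs
begin

text \<open>
  Converse. A code with \<open>M\<close> messages induces a kernel \<open>V(y\<^sup>n | x\<^sup>n, z\<^sup>n) \<le> M * Q(y\<^sup>n | z\<^sup>n)\<close>, so any
  \<open>\<phi> > 0\<close> with \<open>\<Sum>\<^sub>x P(x, z) \<phi>(x, z, y) \<le> P(z)\<close> satisfies \<open>E \<Prod>\<^sub>i \<phi>(X\<^sub>i, Z\<^sub>i, Y\<^sub>i) \<le> M\<close>, and by concavity of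
  the logarithm \<open>n \<Sum> u log \<phi> \<le> log M\<close>, where \<open>u\<close> is the expected joint empirical distribution.
  This bound and both constraints are linear in \<open>u\<close> and survive passing to a limit point \<open>u\<close>; taking for
  \<open>\<phi>\<close> essentially \<open>P(x | y, z) / P(x | z)\<close> under the limit turns the left side into the conditional
  mutual information.

  Achievability. For each \<open>z\<^sup>n\<close> a codebook of slightly more than \<open>2 powr (n * I)\<close> words drawn from the output
  law contains, with high probability, a word jointly typical with \<open>(x\<^sup>n, z\<^sup>n)\<close>. Typicality controls the
  distortion and the total variation distance of the empirical laws at the same time, so one good
  deterministic codebook suffices and no common randomness is needed.
\<close>

section \<open>Joint laws, i.i.d. words and sums over words of fixed length\<close>

definition joint_law :: "'a pmf \<Rightarrow> ('a \<Rightarrow> 'b pmf) \<Rightarrow> ('a \<times> 'b) pmf" where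
  "joint_law P V = bind_pmf P (\<lambda>a. map_pmf (Pair a) (V a))"

text \<open>The memoryless extension of the kernel \<open>V\<close> to words.\<close>

fun indep_pmf :: "('a \<Rightarrow> 'b pmf) \<Rightarrow> 'a list \<Rightarrow> 'b list pmf" where
  "indep_pmf V [] = return_pmf []"
| "indep_pmf V (a # as) = bind_pmf (V a) (\<lambda>b. bind_pmf (indep_pmf V as) (\<lambda>bs. return_pmf (b # bs)))"

lemma pmf_joint_law: "pmf (joint_law P V) (a, b) = pmf P a * pmf (V a) b"
proof -
  have *: "pmf (map_pmf (Pair a') (V a')) (a, b) = indicator {a} a' * pmf (V a) b" for a'
  proof (cases "a' = a")
    case True
    then show ?thesis using pmf_map_inj'[of "Pair a" "V a" b] by (simp add: inj_on_def)
  next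
    case False
    then have "(a, b) \<notin> set_pmf (map_pmf (Pair a') (V a'))" by auto
    then have "pmf (map_pmf (Pair a') (V a')) (a, b) = 0" by (simp only: set_pmf_iff not_not)
    with False show ?thesis by simp
  qed
  show ?thesis unfolding joint_law_def pmf_bind * by (simp add: measure_pmf_single)
qed

lemma pmf_bind_Cons:
  "pmf (bind_pmf p (\<lambda>a. bind_pmf q (\<lambda>as. return_pmf (a # as)))) (x # xs) = pmf p x * pmf q xs"
proof -
  have "bind_pmf p (\<lambda>a. bind_pmf q (\<lambda>as. return_pmf (a # as)))
     = map_pmf (\<lambda>(a, as). a # as) (joint_law p (\<lambda>_. q))"
    by (simp add: joint_law_def map_pmf_def bind_assoc_pmf bind_return_pmf)
  moreover have "inj (\<lambda>(a, as). a # as)" by (auto simp: inj_on_def)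
  ultimately show ?thesis
    using pmf_map_inj'[of "\<lambda>(a, as). a # as" "joint_law p (\<lambda>_. q)" "(x, xs)"]
    by (simp add: pmf_joint_law)
qed

lemma pmf_iid_Cons: "pmf (iid_pmf (Suc n) P) (x # xs) = pmf P x * pmf (iid_pmf n P) xs"
  by (simp add: pmf_bind_Cons)

lemma pmf_indep_Cons: "pmf (indep_pmf V (a # as)) (b # bs) = pmf (V a) b * pmf (indep_pmf V as) bs"
  by (simp add: pmf_bind_Cons)

lemma set_iid_pmf: "xs \<in> set_pmf (iid_pmf n P) \<Longrightarrow> length xs = n \<and> set xs \<subseteq> set_pmf P"
  by (induction n arbitrary: xs) (auto, blast+)

lemma set_indep_pmf: "bs \<in> set_pmf (indep_pmf V as) \<Longrightarrow> length bs = length as"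
  by (induction as arbitrary: bs) auto

text \<open>Independent draws commute: in the induction step the two sides differ only in whether
  the first output letter is drawn before or after the remaining input letters.\<close>

lemma iid_pmf_joint_law:
  "iid_pmf n (joint_law P V) = map_pmf (\<lambda>(as, bs). zip as bs) (joint_law (iid_pmf n P) (indep_pmf V))"
proof (induction n)
  case 0
  then show ?case by (simp add: joint_law_def map_pmf_def bind_return_pmf)
next
  case (Suc n)
  show ?case
    unfolding iid_pmf.simps Suc.IH
    by (simp add: joint_law_def map_pmf_def bind_assoc_pmf bind_return_pmf)
       (subst bind_commute_pmf, simp)
qed

lemma finite_lists_of_length: "finite {xs :: 'a::finite list. length xs = n}"
  using finite_lists_length_eq[of "UNIV :: 'a set" n] by simp

lemma sum_lists_Suc:
  fixes F :: "'a::finite list \<Rightarrow> real"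
  shows "(\<Sum>xs | length xs = Suc n. F xs) = (\<Sum>a\<in>UNIV. \<Sum>xs | length xs = n. F (a # xs))"
proof -
  have "{xs :: 'a list. length xs = Suc n} = (\<lambda>(a, xs). a # xs) ` (UNIV \<times> {xs. length xs = n})"
    by (auto simp: length_Suc_conv)
  moreover have "inj_on (\<lambda>(a :: 'a, xs). a # xs) (UNIV \<times> {xs. length xs = n})"
    by (auto simp: inj_on_def)
  ultimately show ?thesis
    by (simp add: sum.reindex sum.cartesian_product case_prod_unfold)
qed

lemma expectation_lists:
  fixes p :: "'a::finite list pmf" and F :: "'a list \<Rightarrow> real"
  assumes "set_pmf p \<subseteq> {xs. length xs = n}"
  shows "measure_pmf.expectation p F = (\<Sum>xs | length xs = n. pmf p xs * F xs)"
  by (subst integral_measure_pmf_real[of "{xs. length xs = n}"])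
     (use assms finite_lists_of_length in \<open>auto simp: mult.commute\<close>)

lemma expectation_iid:
  fixes P :: "'a::finite pmf" and F :: "'a list \<Rightarrow> real"
  shows "measure_pmf.expectation (iid_pmf n P) F = (\<Sum>xs | length xs = n. pmf (iid_pmf n P) xs * F xs)"
  by (rule expectation_lists) (use set_iid_pmf in auto)

lemma sum_pmf_lists:
  fixes p :: "'a::finite list pmf"
  assumes "set_pmf p \<subseteq> {xs. length xs = n}"
  shows "(\<Sum>xs | length xs = n. pmf p xs) = 1"
  using expectation_lists[OF assms, of "\<lambda>_. 1"] by simp

lemma sum_pmf_iid:
  fixes P :: "'a::finite pmf"
  shows "(\<Sum>xs | length xs = n. pmf (iid_pmf n P) xs) = 1"
  by (rule sum_pmf_lists) (use set_iid_pmf in auto)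

lemma sum_pmf_UNIV: "(\<Sum>a\<in>UNIV. pmf (P :: 'a::finite pmf) a) = 1"
  by (rule sum_pmf_eq_1) auto

lemma expectation_iid_sum_list:
  fixes P :: "'a::finite pmf" and h :: "'a \<Rightarrow> real"
  shows "(\<Sum>xs | length xs = n. pmf (iid_pmf n P) xs * (\<Sum>x\<leftarrow>xs. h x)) = n * (\<Sum>a\<in>UNIV. pmf P a * h a)"
proof (induction n)
  case 0
  then show ?case by simp
next
  case (Suc n)
  have "(\<Sum>xs | length xs = Suc n. pmf (iid_pmf (Suc n) P) xs * (\<Sum>x\<leftarrow>xs. h x))
     = (\<Sum>a\<in>UNIV. \<Sum>xs | length xs = n. pmf P a * h a * pmf (iid_pmf n P) xs + pmf P a * (pmf (iid_pmf n P) xs * (\<Sum>x\<leftarrow>xs. h x)))"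
    unfolding sum_lists_Suc pmf_iid_Cons by (simp add: algebra_simps)
  also have "\<dots> = (\<Sum>a\<in>UNIV. pmf P a * h a + pmf P a * (n * (\<Sum>a\<in>UNIV. pmf P a * h a)))"
    by (simp only: sum.distrib sum_distrib_left[symmetric] Suc.IH sum_pmf_iid mult_1_right)
  also have "\<dots> = Suc n * (\<Sum>a\<in>UNIV. pmf P a * h a)"
    by (simp only: sum.distrib sum_distrib_right[symmetric] sum_pmf_UNIV) (simp add: algebra_simps)
  finally show ?case .
qed

text \<open>The cross term of the expanded square carries the mean of \<open>h\<close>, which
  vanishes, so the variances add up.\<close>

lemma expectation_iid_sum_list_square:
  fixes P :: "'a::finite pmf" and h :: "'a \<Rightarrow> real"
  assumes "(\<Sum>a\<in>UNIV. pmf P a * h a) = 0"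
  shows "(\<Sum>xs | length xs = n. pmf (iid_pmf n P) xs * (\<Sum>x\<leftarrow>xs. h x)\<^sup>2) = n * (\<Sum>a\<in>UNIV. pmf P a * (h a)\<^sup>2)"
proof (induction n)
  case 0
  then show ?case by simp
next
  case (Suc n)
  let ?S = "\<lambda>xs. \<Sum>x\<leftarrow>xs. h x"
  have "(\<Sum>xs | length xs = Suc n. pmf (iid_pmf (Suc n) P) xs * (?S xs)\<^sup>2)
     = (\<Sum>a\<in>UNIV. \<Sum>xs | length xs = n. pmf P a * (h a)\<^sup>2 * pmf (iid_pmf n P) xs
          + 2 * pmf P a * h a * (pmf (iid_pmf n P) xs * ?S xs)
          + pmf P a * (pmf (iid_pmf n P) xs * (?S xs)\<^sup>2))"
    unfolding sum_lists_Suc pmf_iid_Cons by (simp add: algebra_simps power2_eq_square)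
  also have "\<dots> = (\<Sum>a\<in>UNIV. pmf P a * (h a)\<^sup>2 + pmf P a * (n * (\<Sum>a\<in>UNIV. pmf P a * (h a)\<^sup>2)))"
    by (simp only: sum.distrib sum_distrib_left[symmetric] Suc.IH sum_pmf_iid
          expectation_iid_sum_list assms mult_1_right mult_zero_right add_0_right sum.neutral_const)
  also have "\<dots> = Suc n * (\<Sum>a\<in>UNIV. pmf P a * (h a)\<^sup>2)"
    by (simp only: sum.distrib sum_distrib_right[symmetric] sum_pmf_UNIV) (simp add: algebra_simps)
  finally show ?case .
qed

text \<open>Chebyshev's inequality; the bound on \<open>h\<close> keeps the variance of one letter
  at most 1.\<close>

lemma prob_iid_deviation:
  fixes P :: "'a::finite pmf" and h :: "'a \<Rightarrow> real"
  assumes h: "(\<Sum>a\<in>UNIV. pmf P a * h a) = 0" "\<And>a. \<bar>h a\<bar> \<le> 1" and "\<delta> > 0" "n > 0"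
  shows "measure (measure_pmf (iid_pmf n P)) {xs. \<bar>\<Sum>x\<leftarrow>xs. h x\<bar> > real n * \<delta>} \<le> 1 / (real n * \<delta>\<^sup>2)"
proof -
  let ?A = "{xs. \<bar>\<Sum>x\<leftarrow>xs. h x\<bar> > real n * \<delta>}"
  have sq: "(\<Sum>a\<in>UNIV. pmf P a * (h a)\<^sup>2) \<le> (\<Sum>a\<in>UNIV. pmf P a)"
    by (rule sum_mono) (use h(2) in \<open>simp add: mult_left_le abs_square_le_1\<close>)
  have "(real n * \<delta>)\<^sup>2 * measure (measure_pmf (iid_pmf n P)) ?A
     = (\<Sum>xs | length xs = n. pmf (iid_pmf n P) xs * ((real n * \<delta>)\<^sup>2 * indicator ?A xs))"
    using expectation_iid[of n P "indicator ?A"]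
    by (simp add: sum_distrib_left algebra_simps)
  also have "\<dots> \<le> (\<Sum>xs | length xs = n. pmf (iid_pmf n P) xs * (\<Sum>x\<leftarrow>xs. h x)\<^sup>2)"
  proof (intro sum_mono mult_left_mono)
    fix xs
    show "(real n * \<delta>)\<^sup>2 * indicator ?A xs \<le> (\<Sum>x\<leftarrow>xs. h x)\<^sup>2"
      using power_mono[of "n * \<delta>" "\<bar>\<Sum>x\<leftarrow>xs. h x\<bar>" 2] \<open>\<delta> > 0\<close>
      by (auto simp: indicator_def)
  qed auto
  also have "\<dots> \<le> n"
    unfolding expectation_iid_sum_list_square[OF h(1)]
    using mult_left_mono[OF sq, of "real n"] by (simp add: sum_pmf_UNIV)
  finally have "(real n * \<delta>)\<^sup>2 * measure (measure_pmf (iid_pmf n P)) ?A \<le> n" .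
  then show ?thesis using assms(3,4) by (simp add: field_simps power2_eq_square)
qed

section \<open>Empirical distributions as linear functionals\<close>

lemma sum_list_emp:
  fixes h :: "'a::finite \<Rightarrow> real"
  shows "(\<Sum>x\<leftarrow>xs. h x) = length xs * (\<Sum>a\<in>UNIV. emp xs a * h a)"
proof -
  have "(\<Sum>x\<leftarrow>xs. h x) = (\<Sum>a\<in>UNIV. real (length (filter (\<lambda>b. b = a) xs)) * h a)"
  proof (induction xs)
    case (Cons x xs)
    have "real (length (filter (\<lambda>b. b = a) (x # xs))) * h a
        = (if x = a then h a else 0) + real (length (filter (\<lambda>b. b = a) xs)) * h a" for a
      by (simp add: algebra_simps)
    then show ?case using Cons by (simp add: sum.distrib)
  qed simp
  also have "\<dots> = length xs * (\<Sum>a\<in>UNIV. emp xs a * h a)"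
    by (cases "xs = []") (simp_all add: emp_def sum_distrib_left)
  finally show ?thesis .
qed

lemma sum_emp_eq:
  fixes h :: "'a::finite \<Rightarrow> real"
  shows "(\<Sum>a\<in>UNIV. emp xs a * h a) = (\<Sum>x\<leftarrow>xs. h x) / length xs"
  \<comment> \<open>For the empty word both sides are 0, because division by zero gives 0.\<close>
  by (cases "xs = []") (simp_all add: sum_list_emp, simp add: emp_def)

lemma sum_emp_map:
  fixes f :: "'t::finite \<Rightarrow> 'a::finite"
  shows "(\<Sum>a\<in>A. emp (map f ts) a) = (\<Sum>t\<in>UNIV. emp ts t * of_bool (f t \<in> A))"
proof -
  have "(\<Sum>a\<in>A. emp (map f ts) a) = (\<Sum>a\<in>UNIV. emp (map f ts) a * of_bool (a \<in> A))"
    by (rule sum.mono_neutral_cong_left) auto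
  then show ?thesis by (simp add: sum_emp_eq o_def)
qed

lemma emp_nonneg: "0 \<le> emp xs a"
  by (simp add: emp_def)

text \<open>Integrated against a law of \<open>((x, z), y)\<close>, this function gives the
  difference of the probabilities of \<open>A\<close> under the first and the last marginal. The
  perception constraint thereby becomes finitely many bounds on linear functionals of the joint
  law.\<close>

definition marginal_gap :: "'x set \<Rightarrow> ('x \<times> 'z) \<times> 'x \<Rightarrow> real" where
  "marginal_gap A t = of_bool (fst (fst t) \<in> A) - of_bool (snd t \<in> A)"

lemma dtv_le_iff: "dtv p q \<le> c \<longleftrightarrow> (\<forall>A. \<bar>(\<Sum>a\<in>A. p a) - (\<Sum>a\<in>A. q a)\<bar> \<le> c)"
  unfolding dtv_def by (subst cSup_le_iff) auto

lemma dtv_emp_le_iff: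
  fixes xz :: "('x::finite \<times> 'z::finite) list"
  assumes "length ys = length xz"
  shows "dtv (emp (map fst xz)) (emp ys) \<le> c \<longleftrightarrow>
    (\<forall>A. \<bar>\<Sum>t\<in>UNIV. emp (zip xz ys) t * marginal_gap A t\<bar> \<le> c)"
proof -
  have 1: "map fst xz = map (\<lambda>t. fst (fst t)) (zip xz ys)"
    using assms by (simp flip: map_map[of fst fst, unfolded o_def])
  have 2: "ys = map snd (zip xz ys)"
    using assms by simp
  have "(\<Sum>a\<in>A. emp (map fst xz) a) - (\<Sum>a\<in>A. emp ys a)
     = (\<Sum>t\<in>UNIV. emp (zip xz ys) t * marginal_gap A t)" for A
    unfolding 1 by (subst (1) 2, unfold sum_emp_map)
      (simp add: marginal_gap_def right_diff_distrib sum_subtractf)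
  then show ?thesis by (simp add: dtv_le_iff)
qed

lemma dist_n_emp:
  fixes xz :: "('x::finite \<times> 'z::finite) list"
  assumes "length ys = length xz"
  shows "dist_n D (map fst xz) ys = (\<Sum>t\<in>UNIV. emp (zip xz ys) t * D (fst (fst t)) (snd t))"
  using assms by (simp add: sum_emp_eq dist_n_def sum_list_sum_nth atLeast0LessThan)

lemma pmf_map_snd: "pmf (map_pmf snd P) z = (\<Sum>x\<in>UNIV. pmf P (x :: 'x::finite, z :: 'z::finite))"
proof -
  have "pmf (map_pmf snd P) z = sum (pmf P) (snd -` {z})"
    by (simp add: pmf_map measure_measure_pmf_finite)
  also have "snd -` {z} = (\<lambda>x. (x, z)) ` UNIV" by auto
  also have "sum (pmf P) \<dots> = (\<Sum>x\<in>UNIV. pmf P (x, z))"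
    by (subst sum.reindex) (auto simp: inj_on_def)
  finally show ?thesis .
qed

lemma sum_UNIV_prod: "(\<Sum>a\<in>UNIV. F a) = (\<Sum>x\<in>UNIV. \<Sum>z\<in>UNIV. F (x :: 'x::finite, z :: 'z::finite))"
  by (simp add: sum.cartesian_product)

text \<open>For each \<open>y\<close> the hypothesis makes \<phi> a subdensity with respect to the
  law of the source letter given \<open>z\<close>. Hence, for a fixed output word, tilting does not
  increase the total mass of the source words that share one side information word. \<open>H\<close>
  stays arbitrary in the induction so that it can absorb the letters already split off.\<close>

lemma sum_iid_tilted_le:
  fixes P :: "('x::finite \<times> 'z::finite) pmf" and \<phi> :: "('x \<times> 'z) \<times> 'y::finite \<Rightarrow> real"
  assumes \<phi>: "\<And>t. 0 \<le> \<phi> t" "\<And>z y. (\<Sum>x\<in>UNIV. pmf P (x, z) * \<phi> ((x, z), y)) \<le> (\<Sum>x\<in>UNIV. pmf P (x, z))"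
    and H: "\<And>zs ys. 0 \<le> H zs ys"
  shows "(\<Sum>xz | length xz = n. \<Sum>ys | length ys = n.
            pmf (iid_pmf n P) xz * prod_list (map \<phi> (zip xz ys)) * H (map snd xz) ys)
       \<le> (\<Sum>zs | length zs = n. \<Sum>ys | length ys = n. pmf (iid_pmf n (map_pmf snd P)) zs * H zs ys)"
  using H
proof (induction n arbitrary: H)
  case 0
  then show ?case by simp
next
  case (Suc n)
  let ?p = "\<lambda>xz. pmf (iid_pmf n P) xz" and ?pz = "\<lambda>zs. pmf (iid_pmf n (map_pmf snd P)) zs"
  let ?\<Phi> = "\<lambda>xz ys. prod_list (map \<phi> (zip xz ys))"
  define B where "B z y = (\<Sum>zs | length zs = n. \<Sum>ys | length ys = n. ?pz zs * H (z # zs) (y # ys))" for z y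
  have B0: "0 \<le> B z y" for z y
    unfolding B_def using Suc.prems by (intro sum_nonneg mult_nonneg_nonneg) auto
  have "(\<Sum>xz | length xz = Suc n. \<Sum>ys | length ys = Suc n.
            pmf (iid_pmf (Suc n) P) xz * ?\<Phi> xz ys * H (map snd xz) ys)
      = (\<Sum>a\<in>UNIV. \<Sum>y\<in>UNIV. \<Sum>xz | length xz = n. \<Sum>ys | length ys = n.
          pmf P a * \<phi> (a, y) * (?p xz * ?\<Phi> xz ys * H (snd a # map snd xz) (y # ys)))"
    unfolding sum_lists_Suc pmf_iid_Cons
    by (subst (2) sum.swap) (simp add: mult_ac)
  also have "\<dots> = (\<Sum>a\<in>UNIV. \<Sum>y\<in>UNIV. pmf P a * \<phi> (a, y) * (\<Sum>xz | length xz = n. \<Sum>ys | length ys = n.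
           ?p xz * ?\<Phi> xz ys * H (snd a # map snd xz) (y # ys)))"
    by (simp only: sum_distrib_left)
  also have "\<dots> \<le> (\<Sum>a\<in>UNIV. \<Sum>y\<in>UNIV. pmf P a * \<phi> (a, y) * B (snd a) y)"
    unfolding B_def by (intro sum_mono mult_left_mono Suc.IH Suc.prems mult_nonneg_nonneg \<phi>(1)) auto
  also have "\<dots> = (\<Sum>z\<in>UNIV. \<Sum>y\<in>UNIV. (\<Sum>x\<in>UNIV. pmf P (x, z) * \<phi> ((x, z), y)) * B z y)"
    unfolding sum_UNIV_prod sum_distrib_right snd_conv
    by (subst sum.swap) (intro sum.cong refl, rule sum.swap)
  also have "\<dots> \<le> (\<Sum>z\<in>UNIV. \<Sum>y\<in>UNIV. pmf (map_pmf snd P) z * B z y)"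
    unfolding pmf_map_snd by (intro sum_mono mult_right_mono \<phi>(2) B0)
  also have "\<dots> = (\<Sum>zs | length zs = Suc n. \<Sum>ys | length ys = Suc n.
       pmf (iid_pmf (Suc n) (map_pmf snd P)) zs * H zs ys)"
    unfolding sum_lists_Suc pmf_iid_Cons B_def
    by (subst (2) sum.swap) (simp add: mult_ac sum_distrib_left)
  finally show ?case .
qed

lemma expectation_joint_law_lists:
  fixes p :: "'a::finite list pmf" and V :: "'a list \<Rightarrow> 'b::finite list pmf"
  assumes p: "set_pmf p \<subseteq> {xs. length xs = n}" and V: "\<And>xs. set_pmf (V xs) \<subseteq> {ys. length ys = n}"
  shows "measure_pmf.expectation (joint_law p V) F
     = (\<Sum>xs | length xs = n. \<Sum>ys | length ys = n. pmf p xs * pmf (V xs) ys * F (xs, ys))"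
proof -
  have "set_pmf (joint_law p V) \<subseteq> {xs. length xs = n} \<times> {ys. length ys = n}"
    using p V by (fastforce simp: joint_law_def)
  then show ?thesis
    by (subst integral_measure_pmf_real[of "{xs. length xs = n} \<times> {ys. length ys = n}"])
       (auto simp: finite_lists_of_length sum.cartesian_product pmf_joint_law mult_ac intro!: sum.cong)
qed

subsection \<open>Converse\<close>

text \<open>Replaces a block code by one single-letter law \<open>u\<close>, the expected joint
  empirical distribution. The rate bound is stated for all test functions \<phi> instead of as a
  bound on mutual information: each instance is linear in \<open>u\<close>, and the same
  \<open>u\<close> serves them all.\<close>

lemma code_single_letter_bounds:
  fixes P :: "('x::finite \<times> 'z::finite) pmf"
  assumes code: "is_code n R R0 f g" and n: "n > 0" and M0: "M0 > 0"
    and dist: "measure_pmf.expectation (code_joint n P M0 f g) (\<lambda>(xs, ys). dist_n D xs ys) \<le> d"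
    and perc: "measure_pmf.expectation (code_joint n P M0 f g) (\<lambda>(xs, ys). dtv (emp xs) (emp ys)) \<le> p"
  obtains u where "\<And>t. 0 \<le> u t" "\<And>a. (\<Sum>y\<in>UNIV. u (a, y)) = pmf P a"
    "(\<Sum>t\<in>UNIV. u t * D (fst (fst t)) (snd t)) \<le> d"
    "\<And>A. \<bar>\<Sum>t\<in>UNIV. u t * marginal_gap A t\<bar> \<le> p"
    "\<And>\<phi>. (\<And>t. 0 < \<phi> t) \<Longrightarrow>
        (\<And>z y. (\<Sum>x\<in>UNIV. pmf P (x, z) * \<phi> ((x, z), y)) \<le> (\<Sum>x\<in>UNIV. pmf P (x, z))) \<Longrightarrow>
        (\<Sum>t\<in>UNIV. u t * log 2 (\<phi> t)) \<le> R"
proof -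
  define M where "M = nat \<lfloor>2 powr (real n * R)\<rfloor>"
  have f: "set_pmf (f xs zs k) \<subseteq> {1..M}" for xs zs k
    using code by (simp add: is_code_def idx_set_def M_def)
  have g: "set_pmf (g m zs k) \<subseteq> {ys. length ys = n}" for m zs k
    using code by (simp add: is_code_def)
  \<comment> \<open>The support of the encoder's law is nonempty and lies in \<open>{1..M}\<close>;
    this excludes rates so small that the message set is empty.\<close>
  have "{1..M} \<noteq> {}" using f set_pmf_not_empty by fastforce
  then have M: "M > 0" by (cases M) auto
  have K: "{1..M0} \<noteq> {}" using M0 by auto
  define V where "V xz = bind_pmf (pmf_of_set {1..M0}) (\<lambda>k.
     bind_pmf (f (map fst xz) (map snd xz) k) (\<lambda>m. g m (map snd xz) k))" for xz
  \<comment> \<open>The decoder fed with a uniform message: a reference output law that sees the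
    source only through the side information.\<close>
  define Q where "Q zs = bind_pmf (pmf_of_set {1..M0}) (\<lambda>k.
     bind_pmf (pmf_of_set {1..M}) (\<lambda>m. g m zs k))" for zs
  define J where "J = joint_law (iid_pmf n P) V"
  have iid: "set_pmf (iid_pmf n P) \<subseteq> {xz. length xz = n}" using set_iid_pmf by auto
  have V: "set_pmf (V xz) \<subseteq> {ys. length ys = n}" for xz
    using g by (fastforce simp: V_def)
  have Q: "set_pmf (Q zs) \<subseteq> {ys. length ys = n}" for zs
    using g by (fastforce simp: Q_def)
  have J: "length xz = n \<and> length ys = n" if "(xz, ys) \<in> set_pmf J" for xz ys
    using that iid V by (fastforce simp: J_def joint_law_def)
  have "set_pmf J \<subseteq> {xz. length xz = n} \<times> {ys. length ys = n}" using J by auto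
  then have fin: "finite (set_pmf J)"
    by (rule finite_subset) (simp add: finite_lists_of_length)
  have int[simp]: "integrable (measure_pmf J) F" for F :: "_ \<Rightarrow> real"
    by (rule integrable_measure_pmf_finite[OF fin])
  have EJ: "measure_pmf.expectation J F = (\<Sum>xs | length xs = n. \<Sum>ys | length ys = n.
      pmf (iid_pmf n P) xs * pmf (V xs) ys * F (xs, ys))" for F
    unfolding J_def by (rule expectation_joint_law_lists[OF iid V])
  have EJ_mono: "measure_pmf.expectation J F \<le> measure_pmf.expectation J G"
    if "\<And>xz ys. length xz = n \<Longrightarrow> length ys = n \<Longrightarrow> F (xz, ys) \<le> G (xz, ys)" for F G :: "_ \<Rightarrow> real"
    using that J by (intro integral_mono_AE) (auto simp: AE_measure_pmf_iff)
  have EJ_cong: "measure_pmf.expectation J F = measure_pmf.expectation J G"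
    if "\<And>xz ys. length xz = n \<Longrightarrow> length ys = n \<Longrightarrow> F (xz, ys) = G (xz, ys)" for F G :: "_ \<Rightarrow> real"
    using that by (intro antisym EJ_mono) auto
  have code_J: "code_joint n P M0 f g = map_pmf (\<lambda>(xz, ys). (map fst xz, ys)) J"
    by (simp add: code_joint_def J_def joint_law_def V_def map_pmf_def bind_assoc_pmf bind_return_pmf)

  define u where "u t = measure_pmf.expectation J (\<lambda>(xz, ys). emp (zip xz ys) t)" for t
  have u_lin: "(\<Sum>t\<in>UNIV. u t * h t) = measure_pmf.expectation J (\<lambda>(xz, ys). \<Sum>t\<in>UNIV. emp (zip xz ys) t * h t)" for h
    unfolding u_def by (simp add: case_prod_unfold)
  have u0: "0 \<le> u t" for t
    unfolding u_def by (intro Bochner_Integration.integral_nonneg) (auto simp: emp_nonneg)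
  have marg: "(\<Sum>y\<in>UNIV. u (a, y)) = pmf P a" for a
  proof -
    have "(\<Sum>y\<in>UNIV. u (a, y)) = (\<Sum>t\<in>UNIV. u t * of_bool (fst t = a))"
      by (subst sum_UNIV_prod) (simp add: of_bool_def if_distrib[of "(*) _"] sum.swap[of _ UNIV UNIV] cong: if_cong)
    also have "\<dots> = measure_pmf.expectation J (\<lambda>(xz, ys). (\<Sum>x\<leftarrow>xz. of_bool (x = a)) / n)"
      unfolding u_lin
    proof (rule EJ_cong, unfold prod.case)
      fix xz :: "('x \<times> 'z) list" and ys :: "'x list"
      assume *: "length xz = n" "length ys = n"
      then have "(\<Sum>t\<leftarrow>zip xz ys. of_bool (fst t = a)) = (\<Sum>x\<leftarrow>map fst (zip xz ys). of_bool (x = a) :: real)"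
        by (simp only: map_map o_def)
      with * show "(\<Sum>t\<in>UNIV. emp (zip xz ys) t * of_bool (fst t = a)) = (\<Sum>x\<leftarrow>xz. of_bool (x = a)) / n"
        by (simp add: sum_emp_eq)
    qed
    also have "\<dots> = (\<Sum>xz | length xz = n. pmf (iid_pmf n P) xz * (\<Sum>x\<leftarrow>xz. of_bool (x = a))) / n"
    proof -
      have *: "(\<Sum>ys | length ys = n. b * pmf (V xz) ys * c) = b * c" for b c xz
        using sum_pmf_lists[OF V, of xz] by (simp flip: sum_distrib_left sum_distrib_right)
      show ?thesis unfolding EJ prod.case sum_divide_distrib * by simp
    qed
    also have "\<dots> = pmf P a"
      using n by (simp add: expectation_iid_sum_list of_bool_def if_distrib[of "(*) _"] cong: if_cong)
    finally show ?thesis .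
  qed
  have D: "(\<Sum>t\<in>UNIV. u t * D (fst (fst t)) (snd t)) \<le> d"
  proof -
    have "(\<Sum>t\<in>UNIV. u t * D (fst (fst t)) (snd t)) = measure_pmf.expectation J (\<lambda>(xz, ys). dist_n D (map fst xz) ys)"
      unfolding u_lin by (rule EJ_cong) (simp add: dist_n_emp)
    with dist show ?thesis by (simp add: code_J case_prod_unfold)
  qed
  have A: "\<bar>\<Sum>t\<in>UNIV. u t * marginal_gap A t\<bar> \<le> p" for A
  proof -
    \<comment> \<open>Averaging the joint empirical law can only shrink the gap between its
      marginals, so the expected total variation distance dominates.\<close>
    have "\<bar>\<Sum>t\<in>UNIV. u t * marginal_gap A t\<bar>
       \<le> measure_pmf.expectation J (\<lambda>t. \<bar>case t of (xz, ys) \<Rightarrow> \<Sum>t\<in>UNIV. emp (zip xz ys) t * marginal_gap A t\<bar>)"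
      unfolding u_lin by (rule integral_abs_bound)
    also have "\<dots> \<le> measure_pmf.expectation J (\<lambda>(xz, ys). dtv (emp (map fst xz)) (emp ys))"
      by (rule EJ_mono) (use dtv_emp_le_iff in auto)
    also have "\<dots> \<le> p" using perc by (simp add: code_J case_prod_unfold)
    finally show ?thesis .
  qed
  \<comment> \<open>For each key, a message has probability at most 1, which is \<open>M\<close>
    times its uniform probability; the bound is then averaged over the keys.\<close>
  have VQ: "pmf (V xz) ys \<le> M * pmf (Q (map snd xz)) ys" for xz ys
  proof -
    have *: "pmf (bind_pmf q h) ys \<le> M * pmf (bind_pmf (pmf_of_set {1..M}) h) ys"
      if "set_pmf q \<subseteq> {1..M}" for q and h :: "nat \<Rightarrow> 'x list pmf"
    proof -
      have "pmf (bind_pmf q h) ys = (\<Sum>m\<in>{1..M}. pmf (h m) ys * pmf q m)"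
        unfolding pmf_bind by (rule integral_measure_pmf_real) (use that in auto)
      also have "\<dots> \<le> (\<Sum>m\<in>{1..M}. pmf (h m) ys)"
        by (intro sum_mono mult_left_le) (auto simp: pmf_le_1)
      also have "\<dots> = M * pmf (bind_pmf (pmf_of_set {1..M}) h) ys"
        using M \<open>{1..M} \<noteq> {}\<close> by (subst pmf_bind_pmf_of_set) auto
      finally show ?thesis .
    qed
    have "(\<Sum>k\<in>{1..M0}. pmf (bind_pmf (f (map fst xz) (map snd xz) k) (\<lambda>m. g m (map snd xz) k)) ys) / M0
       \<le> (\<Sum>k\<in>{1..M0}. M * pmf (bind_pmf (pmf_of_set {1..M}) (\<lambda>m. g m (map snd xz) k)) ys) / M0"
      by (intro divide_right_mono sum_mono * f) simp
    then show ?thesis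
      unfolding V_def Q_def pmf_bind_pmf_of_set[OF K finite_atLeastAtMost] by (simp add: sum_distrib_left)
  qed
  have rate: "(\<Sum>t\<in>UNIV. u t * log 2 (\<phi> t)) \<le> R"
    if \<phi>: "\<And>t. 0 < \<phi> t" "\<And>z y. (\<Sum>x\<in>UNIV. pmf P (x, z) * \<phi> ((x, z), y)) \<le> (\<Sum>x\<in>UNIV. pmf P (x, z))" for \<phi>
  proof -
    let ?\<Phi> = "\<lambda>xz ys. prod_list (map \<phi> (zip xz ys))"
    have \<Phi>: "0 < prod_list (map \<phi> ts)" for ts by (induction ts) (auto simp: \<phi>)
    have ln\<Phi>: "ln (prod_list (map \<phi> ts)) = (\<Sum>t\<leftarrow>ts. ln (\<phi> t))" for ts
      by (induction ts) (auto simp: ln_mult \<phi> \<Phi> less_imp_neq[symmetric])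
    have "measure_pmf.expectation J (\<lambda>(xz, ys). ?\<Phi> xz ys)
       \<le> (\<Sum>xz | length xz = n. \<Sum>ys | length ys = n.
            pmf (iid_pmf n P) xz * ?\<Phi> xz ys * (M * pmf (Q (map snd xz)) ys))"
      unfolding EJ
    proof (intro sum_mono)
      fix xz ys
      show "pmf (iid_pmf n P) xz * pmf (V xz) ys * (case (xz, ys) of (xz, ys) \<Rightarrow> ?\<Phi> xz ys)
          \<le> pmf (iid_pmf n P) xz * ?\<Phi> xz ys * (M * pmf (Q (map snd xz)) ys)"
        using mult_left_mono[OF VQ[of xz ys], of "pmf (iid_pmf n P) xz * ?\<Phi> xz ys"]
        by (simp add: mult_ac less_imp_le[OF \<Phi>])
    qed
    also have "\<dots> \<le> (\<Sum>zs | length zs = n. \<Sum>ys | length ys = n.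
            pmf (iid_pmf n (map_pmf snd P)) zs * (M * pmf (Q zs) ys))"
      by (rule sum_iid_tilted_le) (auto simp: \<phi> less_imp_le)
    also have "\<dots> = M"
      using sum_pmf_lists[OF Q] sum_pmf_iid[of n "map_pmf snd P"]
      by (simp add: sum_distrib_left[symmetric] sum_distrib_right[symmetric])
    finally have E\<Phi>: "measure_pmf.expectation J (\<lambda>(xz, ys). ?\<Phi> xz ys) \<le> M" .
    have "n * (\<Sum>t\<in>UNIV. u t * ln (\<phi> t)) = measure_pmf.expectation J (\<lambda>(xz, ys). ln (?\<Phi> xz ys))"
      unfolding u_lin integral_mult_right_zero[symmetric]
      by (rule EJ_cong) (simp add: sum_list_emp ln\<Phi>)
    \<comment> \<open>Jensen's inequality through the tangent bound \<open>ln s \<le> s - 1\<close>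
      at \<open>s = ?\<Phi> xz ys / M\<close>, where \<open>s\<close> has mean at most 1.\<close>
    also have "\<dots> \<le> measure_pmf.expectation J (\<lambda>(xz, ys). ?\<Phi> xz ys / M + (ln M - 1))"
    proof (rule EJ_mono, unfold prod.case)
      fix xz ys
      show "ln (?\<Phi> xz ys) \<le> ?\<Phi> xz ys / M + (ln M - 1)"
        using ln_le_minus_one[of "?\<Phi> xz ys / M"] M \<Phi>[of "zip xz ys"] by (simp add: ln_div)
    qed
    also have "\<dots> = measure_pmf.expectation J (\<lambda>(xz, ys). ?\<Phi> xz ys) / M + (ln M - 1)"
      by (simp add: case_prod_unfold)
    also have "\<dots> \<le> ln M" using E\<Phi> M by (simp add: field_simps)
    also have "\<dots> \<le> ln (2 powr (real n * R))"
      using M unfolding M_def by (subst ln_le_cancel_iff) linarith+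
    also have "\<dots> = n * (R * ln 2)" by (simp add: ln_powr)
    finally have "(\<Sum>t\<in>UNIV. u t * ln (\<phi> t)) \<le> R * ln 2" using n by simp
    then show ?thesis
      by (simp add: log_def sum_divide_distrib[symmetric] field_simps)
  qed
  show ?thesis using that[of u] u0 marg D A rate by blast
qed

text \<open>Bolzano-Weierstrass, with functions on a finite type read as vectors of a Euclidean
  space.\<close>

lemma bounded_functions_convergent_subsequence:
  fixes u :: "nat \<Rightarrow> 't::finite \<Rightarrow> real"
  assumes "\<And>j t. \<bar>u j t\<bar> \<le> B"
  obtains r v where "strict_mono (r :: nat \<Rightarrow> nat)" "\<And>t. (\<lambda>j. u (r j) t) \<longlonglongrightarrow> v t"
proof -
  let ?w = "\<lambda>j. \<chi> t. u j t"
  have "norm (?w j) \<le> (\<Sum>t\<in>(UNIV :: 't set). B)" for j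
    by (rule order_trans[OF norm_le_l1_cart], rule sum_mono) (simp add: assms)
  then have "bounded (range ?w)" by (auto simp: bounded_iff)
  then obtain l r where r: "strict_mono r" "(?w \<circ> r) \<longlonglongrightarrow> l"
    using bounded_imp_convergent_subsequence by blast
  have "(\<lambda>j. u (r j) t) \<longlonglongrightarrow> l $ t" for t
    using tendsto_vec_nth[OF r(2), of t] by (simp add: o_def)
  then show ?thesis using that[of r "\<lambda>t. l $ t"] r(1) by blast
qed

section \<open>Single-letter channel laws, information ratio and the limit argument\<close>

definition channel_law :: "('x \<times> 'z) pmf \<Rightarrow> ('x \<Rightarrow> 'z \<Rightarrow> 'x pmf) \<Rightarrow> (('x \<times> 'z) \<times> 'x) pmf" where
  "channel_law P W = joint_law P (\<lambda>a. W (fst a) (snd a))"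

lemma pmf_channel_law: "pmf (channel_law P W) ((x, z), y) = pmf P (x, z) * pmf (W x z) y"
  by (simp add: channel_law_def pmf_joint_law)

text \<open>The ratio P(x | y, z) / P(x | z), equivalently P(y | x, z) / P(y | z); its logarithm is
  the conditional information density. Since division by zero gives 0, it vanishes off the support
  of the channel law.\<close>

definition info_ratio :: "('x::finite \<times> 'z::finite) pmf \<Rightarrow> ('x \<Rightarrow> 'z \<Rightarrow> 'x pmf) \<Rightarrow> ('x \<times> 'z) \<times> 'x \<Rightarrow> real" where
  "info_ratio P W = (\<lambda>((x, z), y).
     pmf (channel_law P W) ((x, z), y) * (\<Sum>x'\<in>UNIV. pmf P (x', z)) /
     (pmf P (x, z) * (\<Sum>x'\<in>UNIV. pmf (channel_law P W) ((x', z), y))))"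

lemma sum_channel_law:
  fixes P :: "('x::finite \<times> 'z::finite) pmf"
  shows "(\<Sum>t\<in>UNIV. pmf (channel_law P W) t * h t)
    = (\<Sum>x\<in>UNIV. \<Sum>z\<in>UNIV. \<Sum>y\<in>UNIV. pmf P (x, z) * pmf (W x z) y * h ((x, z), y))"
  by (simp add: sum_UNIV_prod pmf_channel_law)

lemma cond_mi_eq:
  "cond_mi P W = (\<Sum>t\<in>UNIV. pmf (channel_law P W) t * log 2 (info_ratio P W t))"
  unfolding sum_channel_law
  by (auto simp: cond_mi_def info_ratio_def pmf_channel_law Let_def intro!: sum.cong)

lemma exp_dist_eq:
  "exp_dist P W D = (\<Sum>t\<in>UNIV. pmf (channel_law P W) t * D (fst (fst t)) (snd t))"
  unfolding sum_channel_law by (simp add: exp_dist_def)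

text \<open>The single-letter counterpart of \<open>dtv_emp_le_iff\<close>: the functionals
  \<open>marginal_gap A\<close> express perception on both sides.\<close>

lemma dtv_marginals_le_iff:
  "dtv (PX P) (PY P W) \<le> c \<longleftrightarrow> (\<forall>A. \<bar>\<Sum>t\<in>UNIV. pmf (channel_law P W) t * marginal_gap A t\<bar> \<le> c)"
proof -
  have PX: "PX P x = (\<Sum>z\<in>UNIV. \<Sum>y\<in>UNIV. pmf P (x, z) * pmf (W x z) y)" for x
    by (simp add: PX_def sum_distrib_left[symmetric] sum_pmf_UNIV)
  have *: "(\<Sum>a\<in>A. PX P a) = (\<Sum>x\<in>UNIV. of_bool (x \<in> A) * PX P x)" for A
    by (rule sum.mono_neutral_cong_left) auto
  have X: "(\<Sum>a\<in>A. PX P a) = (\<Sum>t\<in>UNIV. pmf (channel_law P W) t * of_bool (fst (fst t) \<in> A))" for A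
    unfolding sum_channel_law * unfolding PX sum_distrib_left fst_conv
    by (intro sum.cong refl) (simp only: mult_ac)
  have "(\<Sum>a\<in>A. PY P W a) = (\<Sum>y\<in>UNIV. of_bool (y \<in> A) * PY P W y)" for A
    by (rule sum.mono_neutral_cong_left) auto
  also have "\<dots> A = (\<Sum>y\<in>UNIV. \<Sum>x\<in>UNIV. \<Sum>z\<in>UNIV. pmf P (x, z) * pmf (W x z) y * of_bool (y \<in> A))" for A
    unfolding PY_def sum_distrib_left by (intro sum.cong refl) (simp only: mult_ac)
  also have "\<dots> A = (\<Sum>x\<in>UNIV. \<Sum>z\<in>UNIV. \<Sum>y\<in>UNIV. pmf P (x, z) * pmf (W x z) y * of_bool (y \<in> A))" for A
    by (subst sum.swap) (intro sum.cong refl, rule sum.swap)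
  finally have Y: "(\<Sum>a\<in>A. PY P W a) = (\<Sum>t\<in>UNIV. pmf (channel_law P W) t * of_bool (snd t \<in> A))" for A
    unfolding sum_channel_law by simp
  show ?thesis
    by (simp add: dtv_le_iff X Y marginal_gap_def right_diff_distrib sum_subtractf)
qed

lemma info_ratio_nonneg: "0 \<le> info_ratio P W t"
  by (auto simp: info_ratio_def sum_nonneg split: prod.split)

lemma info_ratio_pos:
  assumes "0 < pmf (channel_law P W) t"
  shows "0 < info_ratio P W t"
proof -
  obtain x z y where t: "t = ((x, z), y)" by (metis surj_pair)
  have P: "0 < pmf P (x, z)"
    using assms by (simp add: t pmf_channel_law zero_less_mult_iff)
  have "0 < (\<Sum>x'\<in>UNIV. pmf P (x', z))"
    by (rule sum_pos2[of _ x]) (use P in auto)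
  moreover have "0 < (\<Sum>x'\<in>UNIV. pmf (channel_law P W) ((x', z), y))"
    by (rule sum_pos2[of _ x]) (use assms t in auto)
  ultimately show ?thesis using assms P by (simp add: info_ratio_def t)
qed

text \<open>Summing P(x | y, z) over \<open>x\<close> gives 1, or 0 when \<open>(z, y)\<close> has
  no mass, hence the inequality. Up to strict positivity this makes the ratio an admissible test
  function in \<open>code_single_letter_bounds\<close>.\<close>

lemma sum_info_ratio_le:
  "(\<Sum>x\<in>UNIV. pmf P (x, z) * info_ratio P W ((x, z), y)) \<le> (\<Sum>x\<in>UNIV. pmf P (x, z))"
proof -
  let ?T = "\<lambda>x. pmf (channel_law P W) ((x, z), y)" and ?pz = "\<Sum>x\<in>UNIV. pmf P (x, z)"
  have "pmf P (x, z) * info_ratio P W ((x, z), y) = ?T x * (?pz / (\<Sum>x\<in>UNIV. ?T x))" for x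
    by (cases "pmf P (x, z) = 0") (simp_all add: info_ratio_def pmf_channel_law)
  then have "(\<Sum>x\<in>UNIV. pmf P (x, z) * info_ratio P W ((x, z), y)) = (\<Sum>x\<in>UNIV. ?T x) * (?pz / (\<Sum>x\<in>UNIV. ?T x))"
    by (simp only: sum_distrib_right)
  also have "\<dots> \<le> ?pz"
    by (cases "(\<Sum>x\<in>UNIV. ?T x) = 0") (simp_all add: sum_nonneg)
  finally show ?thesis .
qed

text \<open>Disintegration: \<open>V a\<close> is the normalized row of \<open>u\<close>. Where
  \<open>pmf P a = 0\<close> the row of \<open>u\<close> vanishes too, so the unspecified value of
  \<open>embed_pmf\<close> there is only ever multiplied by 0.\<close>

lemma ex_joint_law:
  fixes P :: "'a pmf" and u :: "'a \<times> 'b::finite \<Rightarrow> real"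
  assumes "\<And>t. 0 \<le> u t" "\<And>a. (\<Sum>b\<in>UNIV. u (a, b)) = pmf P a"
  obtains V where "\<And>t. pmf (joint_law P V) t = u t"
proof -
  define V where "V a = embed_pmf (\<lambda>b. u (a, b) / pmf P a)" for a
  have "pmf (joint_law P V) (a, b) = u (a, b)" for a b
  proof (cases "pmf P a = 0")
    case True
    then have "\<forall>b\<in>UNIV. u (a, b) = 0"
      using assms by (subst sum_nonneg_eq_0_iff[symmetric]) auto
    with True show ?thesis by (simp add: pmf_joint_law)
  next
    case False
    have "pmf (V a) b = u (a, b) / pmf P a"
      unfolding V_def
    proof (rule pmf_embed_pmf)
      show "(\<integral>\<^sup>+ x. ennreal (u (a, x) / pmf P a) \<partial>count_space UNIV) = 1"
        using False assms
        by (subst nn_integral_count_space_finite) (auto simp: sum_ennreal sum_divide_distrib[symmetric])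
    qed (use assms in auto)
    with False show ?thesis by (simp add: pmf_joint_law)
  qed
  then have "pmf (joint_law P V) t = u t" for t by (metis surj_pair)
  then show ?thesis using that by blast
qed

text \<open>A limit of single-letter laws meets the constraints exactly and not only up to a
  tolerance. This compactness argument takes the place of continuity of the informational function
  in the constraint levels.\<close>

theorem ex_channel_of_achievable:
  fixes P :: "('x::finite \<times> 'z::finite) pmf"
  assumes ach: "achievable_e P D R R0 Dc Pc" and "R0 \<ge> 0"
  obtains W where "exp_dist P W D \<le> Dc" "dtv (PX P) (PY P W) \<le> Pc" "cond_mi P W \<le> R"
proof -
  define e where "e j = 1 / real (Suc j)" for j
  have e: "e j > 0" for j by (simp add: e_def)
  have e0: "e \<longlonglongrightarrow> 0" unfolding e_def using LIMSEQ_inverse_real_of_nat by (simp add: inverse_eq_divide)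
  define good where "good j u \<longleftrightarrow> (\<forall>t. 0 \<le> u t) \<and> (\<forall>a. (\<Sum>y\<in>UNIV. u (a, y)) = pmf P a) \<and>
    (\<Sum>t\<in>UNIV. u t * D (fst (fst t)) (snd t)) \<le> Dc + e j \<and>
    (\<forall>A. \<bar>\<Sum>t\<in>UNIV. u t * marginal_gap A t\<bar> \<le> Pc + e j) \<and>
    (\<forall>\<phi>. (\<forall>t. 0 < \<phi> t) \<longrightarrow>
        (\<forall>z y. (\<Sum>x\<in>UNIV. pmf P (x, z) * \<phi> ((x, z), y)) \<le> (\<Sum>x\<in>UNIV. pmf P (x, z))) \<longrightarrow>
        (\<Sum>t\<in>UNIV. u t * log 2 (\<phi> t)) \<le> R + e j)" for j u
  have "\<exists>u. good j u" for j
  proof -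
    obtain N where N: "\<And>n. n \<ge> N \<Longrightarrow> \<exists>f g. is_code n (R + e j) (R0 + e j) f g \<and>
        (let J = code_joint n P (nat \<lfloor>2 powr (real n * (R0 + e j))\<rfloor>) f g in
           measure_pmf.expectation J (\<lambda>(xs, ys). dist_n D xs ys) \<le> Dc + e j \<and>
           measure_pmf.expectation J (\<lambda>(xs, ys). dtv (emp xs) (emp ys)) \<le> Pc + e j)"
      using ach e[of j] unfolding achievable_e_def by blast
    \<comment> \<open>One block length per tolerance is enough; the successor makes it
      positive.\<close>
    define n where "n = Suc N"
    obtain f g where code: "is_code n (R + e j) (R0 + e j) f g"
        "measure_pmf.expectation (code_joint n P (nat \<lfloor>2 powr (real n * (R0 + e j))\<rfloor>) f g) (\<lambda>(xs, ys). dist_n D xs ys) \<le> Dc + e j"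
        "measure_pmf.expectation (code_joint n P (nat \<lfloor>2 powr (real n * (R0 + e j))\<rfloor>) f g) (\<lambda>(xs, ys). dtv (emp xs) (emp ys)) \<le> Pc + e j"
      using N[of n] by (auto simp: n_def Let_def)
    \<comment> \<open>The key set is nonempty, so \<open>pmf_of_set\<close> is its uniform
      law.\<close>
    have "1 \<le> 2 powr (real n * (R0 + e j))"
      using \<open>R0 \<ge> 0\<close> e[of j] by (intro ge_one_powr_ge_zero) auto
    then have pos: "0 < nat \<lfloor>2 powr (real n * (R0 + e j))\<rfloor>" by linarith
    show ?thesis
      by (rule code_single_letter_bounds[OF code(1) _ pos code(2,3)]) (simp add: n_def, unfold good_def, blast)
  qed
  then obtain u where "\<And>j. good j (u j)" by metis
  then have u: "\<And>j t. 0 \<le> u j t" "\<And>j a. (\<Sum>y\<in>UNIV. u j (a, y)) = pmf P a"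
    "\<And>j. (\<Sum>t\<in>UNIV. u j t * D (fst (fst t)) (snd t)) \<le> Dc + e j"
    "\<And>j A. \<bar>\<Sum>t\<in>UNIV. u j t * marginal_gap A t\<bar> \<le> Pc + e j"
    "\<And>j \<phi>. (\<And>t. 0 < \<phi> t) \<Longrightarrow>
        (\<And>z y. (\<Sum>x\<in>UNIV. pmf P (x, z) * \<phi> ((x, z), y)) \<le> (\<Sum>x\<in>UNIV. pmf P (x, z))) \<Longrightarrow>
        (\<Sum>t\<in>UNIV. u j t * log 2 (\<phi> t)) \<le> R + e j"
    unfolding good_def by blast+
  have "u j (a, y) \<le> 1" for j a y
    using member_le_sum[of y UNIV "\<lambda>y. u j (a, y)"] u(1,2) pmf_le_1[of P a] by (simp add: order_trans)
  then have "\<bar>u j t\<bar> \<le> 1" for j t using u(1) by (cases t) simp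
  then obtain r v where r: "strict_mono (r :: nat \<Rightarrow> nat)" and lim: "\<And>t. (\<lambda>j. u (r j) t) \<longlonglongrightarrow> v t"
    using bounded_functions_convergent_subsequence by blast
  have er: "(\<lambda>j. c + e (r j)) \<longlonglongrightarrow> c" for c
    using tendsto_add[OF tendsto_const LIMSEQ_subseq_LIMSEQ[OF e0 r], of c] by (simp add: o_def)
  have lin: "(\<lambda>j. \<Sum>t\<in>UNIV. u (r j) t * h t) \<longlonglongrightarrow> (\<Sum>t\<in>UNIV. v t * h t)" for h
    by (intro tendsto_intros lim)
  have v0: "0 \<le> v t" for t
    by (rule LIMSEQ_le_const[OF lim]) (use u(1) in auto)
  have marg: "(\<Sum>y\<in>UNIV. v (a, y)) = pmf P a" for a
  proof -
    have "(\<lambda>j. \<Sum>y\<in>UNIV. u (r j) (a, y)) \<longlonglongrightarrow> (\<Sum>y\<in>UNIV. v (a, y))"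
      by (intro tendsto_intros lim)
    then show ?thesis unfolding u(2) by (rule LIMSEQ_unique[OF tendsto_const, symmetric])
  qed
  obtain V where V: "\<And>t. pmf (joint_law P V) t = v t"
    using ex_joint_law[OF v0 marg] by blast
  define W where "W x z = V (x, z)" for x z
  have T: "pmf (channel_law P W) t = v t" for t
    by (simp add: channel_law_def W_def V)
  have "exp_dist P W D \<le> Dc"
    unfolding exp_dist_eq T by (rule LIMSEQ_le[OF lin er]) (use u(3) in auto)
  moreover have "dtv (PX P) (PY P W) \<le> Pc"
    unfolding dtv_marginals_le_iff T
    by (intro allI LIMSEQ_le[OF tendsto_rabs[OF lin] er]) (use u(4) in auto)
  moreover have "cond_mi P W \<le> R"
  proof (rule field_le_epsilon)
    fix \<epsilon> :: real assume \<epsilon>: "\<epsilon> > 0"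
    text \<open>Mixing the limit's ratio with 1 keeps the test function positive, so that its logarithm is
      finite and the limit of the linear functionals can be taken.\<close>
    define \<eta> where "\<eta> = 1 - 2 powr (- \<epsilon>)"
    have \<eta>: "0 < \<eta>" "\<eta> < 1" "log 2 (1 - \<eta>) = - \<epsilon>"
      using \<epsilon> by (auto simp: \<eta>_def powr_less_one)
    define \<phi> where "\<phi> t = (1 - \<eta>) * info_ratio P W t + \<eta>" for t
    have \<phi>0: "0 < \<phi> t" for t
      using \<eta> info_ratio_nonneg[of P W t] by (simp add: \<phi>_def add_nonneg_pos)
    \<comment> \<open>Admissibility is a convex condition that holds for the ratio and for the
      constant 1.\<close>
    have \<phi>1: "(\<Sum>x\<in>UNIV. pmf P (x, z) * \<phi> ((x, z), y)) \<le> (\<Sum>x\<in>UNIV. pmf P (x, z))" for z y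
    proof -
      have "(\<Sum>x\<in>UNIV. pmf P (x, z) * \<phi> ((x, z), y))
        = (1 - \<eta>) * (\<Sum>x\<in>UNIV. pmf P (x, z) * info_ratio P W ((x, z), y)) + \<eta> * (\<Sum>x\<in>UNIV. pmf P (x, z))"
        by (simp add: \<phi>_def sum_distrib_left sum.distrib distrib_left mult_ac)
      also have "\<dots> \<le> (1 - \<eta>) * (\<Sum>x\<in>UNIV. pmf P (x, z)) + \<eta> * (\<Sum>x\<in>UNIV. pmf P (x, z))"
        using \<eta> sum_info_ratio_le by (intro add_mono mult_left_mono) auto
      finally show ?thesis by (simp add: algebra_simps)
    qed
    \<comment> \<open>Dropping the summand \<eta> lowers the logarithm, and \<eta> was chosen so
      that the remaining factor \<open>1 - \<eta>\<close> costs exactly \<epsilon>.\<close>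
    have "v t * log 2 (info_ratio P W t) - \<epsilon> * v t \<le> v t * log 2 (\<phi> t)" for t
    proof (cases "v t = 0")
      case False
      then have pos: "0 < info_ratio P W t"
        using v0[of t] by (intro info_ratio_pos) (simp add: T)
      have "log 2 (info_ratio P W t) - \<epsilon> = log 2 ((1 - \<eta>) * info_ratio P W t)"
        using pos \<eta> by (simp add: log_mult)
      also have "\<dots> \<le> log 2 (\<phi> t)"
        using pos \<eta> by (subst log_le_cancel_iff) (auto simp: \<phi>_def intro: add_pos_pos)
      finally show ?thesis using v0[of t] mult_left_mono by (fastforce simp: algebra_simps)
    qed simp
    then have "(\<Sum>t\<in>UNIV. v t * log 2 (info_ratio P W t) - \<epsilon> * v t) \<le> (\<Sum>t\<in>UNIV. v t * log 2 (\<phi> t))"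
      by (rule sum_mono)
    also have "\<dots> \<le> R"
      by (rule LIMSEQ_le[OF lin er]) (use u(5)[OF \<phi>0 \<phi>1] in auto)
    also have "(\<Sum>t\<in>UNIV. v t * log 2 (info_ratio P W t) - \<epsilon> * v t) = cond_mi P W - \<epsilon>"
      using sum_pmf_UNIV[of "channel_law P W"]
      by (simp add: cond_mi_eq T sum_subtractf sum_distrib_left[symmetric])
    finally show "cond_mi P W \<le> R + \<epsilon>" by simp
  qed
  ultimately show ?thesis using that by blast
qed

subsection \<open>Random coding\<close>

lemma measure_bind_pmf:
  "measure (measure_pmf (bind_pmf p f)) A = measure_pmf.expectation p (\<lambda>a. measure (measure_pmf (f a)) A)"
proof -
  have "ennreal (measure (measure_pmf (bind_pmf p f)) A) = (\<integral>\<^sup>+a. ennreal (measure (measure_pmf (f a)) A) \<partial>measure_pmf p)"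
    by (simp flip: measure_pmf.emeasure_eq_measure)
  also have "\<dots> = ennreal (measure_pmf.expectation p (\<lambda>a. measure (measure_pmf (f a)) A))"
    by (intro nn_integral_eq_integral measure_pmf.integrable_const_bound[where B = 1]) auto
  finally show ?thesis by (simp add: integral_nonneg_AE)
qed

lemma prob_iid_avoid:
  "measure (measure_pmf (iid_pmf M Q)) {c. set c \<inter> G = {}} = (1 - measure (measure_pmf Q) G) ^ M"
proof (induction M)
  case 0
  then show ?case by simp
next
  case (Suc M)
  have vimage: "(#) a -` {c. set c \<inter> G = {}} = (if a \<in> G then {} else {c. set c \<inter> G = {}})" for a
    by auto
  have "measure (measure_pmf (iid_pmf (Suc M) Q)) {c. set c \<inter> G = {}}
      = measure_pmf.expectation Q (\<lambda>a. indicator (- G) a * (1 - measure (measure_pmf Q) G) ^ M)"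
    unfolding iid_pmf.simps map_pmf_def[symmetric] measure_bind_pmf measure_map_pmf vimage
    by (intro Bochner_Integration.integral_cong) (auto simp: Suc.IH indicator_def)
  also have "\<dots> = (1 - measure (measure_pmf Q) G) ^ Suc M"
    using measure_pmf.prob_compl[of G Q] by (simp add: Compl_eq_Diff_UNIV)
  finally show ?case .
qed

text \<open>\<open>q\<close> is the chance that one random codeword fits, \<open>v\<close> the
  chance under the true conditional law. After \<open>(1 - q) ^ M \<le> exp (- (M * q))\<close>,
  convexity of \<open>exp\<close> splits off \<open>1 - v\<close>, leaving a bound affine in
  \<open>v\<close> that can be averaged over source words.\<close>

lemma one_minus_power_le:
  fixes v q K :: real
  assumes "0 \<le> v" "v \<le> 1" "v \<le> K * q" "q \<le> 1" "K > 0"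
  shows "(1 - q) ^ M \<le> 1 - v + exp (- (M / K))"
proof -
  have "(1 - q) ^ M \<le> exp (- q) ^ M"
    using assms exp_ge_add_one_self[of "- q"] by (intro power_mono) auto
  also have "\<dots> = exp (- (M * q))" by (simp add: exp_of_nat_mult[symmetric])
  also have "\<dots> \<le> exp ((1 - v) * 0 + v * (- (M / K)))"
    using mult_left_mono[OF assms(3), of "real M"] assms(5) by (simp add: field_simps)
  also have "\<dots> \<le> (1 - v) * exp 0 + v * exp (- (M / K))"
    using convex_onD[OF exp_convex, of v 0 "- (M / K)"] assms by simp
  also have "\<dots> \<le> 1 - v + exp (- (M / K))"
    using assms by (simp add: mult_left_le_one_le)
  finally show ?thesis .
qed

text \<open>Random coding: \<open>M\<close> independent words of law \<open>Q\<close> satisfy the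
  bound on average, so some list in the support satisfies it. The weights let one list serve many
  source words at once.\<close>

lemma ex_covering_list:
  fixes a :: "'s \<Rightarrow> real" and V :: "'s \<Rightarrow> 'y pmf" and Q :: "'y pmf"
  assumes "finite S" and a: "\<And>s. s \<in> S \<Longrightarrow> 0 \<le> a s" and "K > 0"
    and fin: "\<And>s. s \<in> S \<Longrightarrow> finite (G s)"
    and dom: "\<And>s y. s \<in> S \<Longrightarrow> y \<in> G s \<Longrightarrow> pmf (V s) y \<le> K * pmf Q y"
  obtains c where "length c = M"
    "(\<Sum>s\<in>S. a s * of_bool (set c \<inter> G s = {}))
       \<le> (\<Sum>s\<in>S. a s * (1 - measure (measure_pmf (V s)) (G s) + exp (- (M / K))))"
proof -
  let ?F = "\<lambda>c. \<Sum>s\<in>S. a s * indicator {c. set c \<inter> G s = {}} c"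
  let ?I = "iid_pmf M Q"
  have int: "integrable (measure_pmf ?I) (indicator A :: _ \<Rightarrow> real)" for A
    by (rule measure_pmf.integrable_const_bound[where B = 1]) auto
  have intF: "integrable (measure_pmf ?I) ?F"
    by (intro Bochner_Integration.integrable_sum integrable_mult_right int)
  have "measure_pmf.expectation ?I ?F = (\<Sum>s\<in>S. a s * (1 - measure (measure_pmf Q) (G s)) ^ M)"
    by (subst Bochner_Integration.integral_sum) (simp_all add: int prob_iid_avoid)
  also have "\<dots> \<le> (\<Sum>s\<in>S. a s * (1 - measure (measure_pmf (V s)) (G s) + exp (- (M / K))))"
  proof (intro sum_mono mult_left_mono a one_minus_power_le)
    fix s assume s: "s \<in> S"
    show "measure (measure_pmf (V s)) (G s) \<le> K * measure (measure_pmf Q) (G s)"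
      by (simp add: measure_measure_pmf_finite fin[OF s] sum_distrib_left dom[OF s] sum_mono)
  qed (use \<open>K > 0\<close> in auto)
  finally have *: "measure_pmf.expectation ?I ?F
     \<le> (\<Sum>s\<in>S. a s * (1 - measure (measure_pmf (V s)) (G s) + exp (- (M / K))))" .
  have "\<not> (AE c in measure_pmf ?I. measure_pmf.expectation ?I ?F < ?F c)"
    using measure_pmf.expectation_greater[OF intF] by blast
  then obtain c where "c \<in> set_pmf ?I" "?F c \<le> measure_pmf.expectation ?I ?F"
    by (auto simp: AE_measure_pmf_iff not_less)
  with * that[of c] set_iid_pmf[of c M Q] show ?thesis
    by (simp add: indicator_def of_bool_def)
qed

lemma prob_iid_joint_law:
  "measure (measure_pmf (iid_pmf n (joint_law P V))) G
     = measure_pmf.expectation (iid_pmf n P)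
         (\<lambda>as. measure (measure_pmf (indep_pmf V as)) {bs. length bs = length as \<and> zip as bs \<in> G})"
proof -
  have "measure (measure_pmf (indep_pmf V as)) {bs. zip as bs \<in> G}
     = measure (measure_pmf (indep_pmf V as)) {bs. length bs = length as \<and> zip as bs \<in> G}" for as
    by (rule measure_pmf.finite_measure_eq_AE) (auto simp: AE_measure_pmf_iff set_indep_pmf)
  then show ?thesis
    by (simp add: iid_pmf_joint_law measure_map_pmf joint_law_def[of "iid_pmf n P"] measure_bind_pmf vimage_def)
qed

text \<open>The side information is known at both ends, so a codebook may be chosen separately for
  each class of source words with the same \<open>map snd\<close>; the resulting bounds are added
  over the classes.\<close>

lemma ex_covering_codebooks:
  fixes P :: "('x::finite \<times> 'z::finite) pmf" and V :: "'x \<times> 'z \<Rightarrow> 'y::finite pmf" and Q :: "'z \<Rightarrow> 'y pmf"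
  assumes "K > 0"
    and dom: "\<And>xz ys. length xz = n \<Longrightarrow> length ys = n \<Longrightarrow> zip xz ys \<in> G \<Longrightarrow>
       pmf (indep_pmf V xz) ys \<le> K * pmf (indep_pmf Q (map snd xz)) ys"
  obtains c where "\<And>zs. length (c zs) = M"
    "measure (measure_pmf (iid_pmf n P)) {xz. \<forall>ys\<in>set (c (map snd xz)). \<not> (length ys = n \<and> zip xz ys \<in> G)}
       \<le> measure (measure_pmf (iid_pmf n (joint_law P V))) (- G) + exp (- (M / K))"
proof -
  let ?p = "\<lambda>xz. pmf (iid_pmf n P) xz"
  define S where "S zs = {xz :: ('x \<times> 'z) list. length xz = n \<and> map snd xz = zs}" for zs
  define H where "H xz = {ys. length ys = n \<and> zip xz ys \<in> G}" for xz
  define w where "w xz = 1 - measure (measure_pmf (indep_pmf V xz)) (H xz) + exp (- (M / K))" for xz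
  define good where "good zs c \<longleftrightarrow> length c = M \<and>
    (\<Sum>xz\<in>S zs. ?p xz * of_bool (set c \<inter> H xz = {})) \<le> (\<Sum>xz\<in>S zs. ?p xz * w xz)" for zs c
  have "\<exists>c. good zs c" for zs
  proof (rule ex_covering_list[of "S zs" ?p K H "indep_pmf V" "indep_pmf Q zs" M])
    show "finite (S zs)" by (simp add: S_def finite_lists_of_length)
    show "finite (H xz)" for xz by (simp add: H_def finite_lists_of_length)
    show "pmf (indep_pmf V xz) ys \<le> K * pmf (indep_pmf Q zs) ys" if "xz \<in> S zs" "ys \<in> H xz" for xz ys
      using that dom by (auto simp: S_def H_def)
  qed (use \<open>K > 0\<close> in \<open>auto simp: w_def good_def\<close>)
  then obtain c where "\<And>zs. good zs (c zs)" by metis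
  then have c: "\<And>zs. length (c zs) = M"
    "\<And>zs. (\<Sum>xz\<in>S zs. ?p xz * of_bool (set (c zs) \<inter> H xz = {})) \<le> (\<Sum>xz\<in>S zs. ?p xz * w xz)"
    by (auto simp: good_def)
  have group: "(\<Sum>xz | length xz = n. F xz) = (\<Sum>zs | length zs = n. \<Sum>xz\<in>S zs. F xz)" for F :: "_ \<Rightarrow> real"
    using sum.group[of "{xz :: ('x \<times> 'z) list. length xz = n}" "{zs. length zs = n}" "map snd" F]
    by (simp add: S_def finite_lists_of_length image_subset_iff)
  let ?E = "{xz. \<forall>ys\<in>set (c (map snd xz)). \<not> (length ys = n \<and> zip xz ys \<in> G)}"
  have "measure (measure_pmf (iid_pmf n P)) ?E = (\<Sum>xz | length xz = n. ?p xz * indicator ?E xz)"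
    using expectation_iid[of n P "indicator ?E"] by simp
  also have "\<dots> = (\<Sum>zs | length zs = n. \<Sum>xz\<in>S zs. ?p xz * of_bool (set (c zs) \<inter> H xz = {}))"
    unfolding group by (intro sum.cong refl) (auto simp: S_def H_def indicator_def)
  also have "\<dots> \<le> (\<Sum>zs | length zs = n. \<Sum>xz\<in>S zs. ?p xz * w xz)"
    by (intro sum_mono c(2))
  also have "\<dots> = (\<Sum>xz | length xz = n. ?p xz * (1 + exp (- (M / K))) - ?p xz * measure (measure_pmf (indep_pmf V xz)) (H xz))"
    unfolding group[symmetric] by (intro sum.cong refl) (simp add: w_def algebra_simps)
  also have "\<dots> = 1 + exp (- (M / K)) - (\<Sum>xz | length xz = n. ?p xz * measure (measure_pmf (indep_pmf V xz)) (H xz))"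
    by (simp add: sum_subtractf sum_distrib_right[symmetric] sum_pmf_iid)
  also have "(\<Sum>xz | length xz = n. ?p xz * measure (measure_pmf (indep_pmf V xz)) (H xz))
      = measure (measure_pmf (iid_pmf n (joint_law P V))) G"
    unfolding prob_iid_joint_law expectation_iid by (intro sum.cong refl) (simp add: H_def)
  also have "1 + exp (- (M / K)) - \<dots> = measure (measure_pmf (iid_pmf n (joint_law P V))) (- G) + exp (- (M / K))"
    using measure_pmf.prob_compl[of G "iid_pmf n (joint_law P V)"] by (simp add: Compl_eq_Diff_UNIV)
  finally show ?thesis using that[of c] c(1) by blast
qed

section \<open>Typical words and the change of measure\<close>

text \<open>Strong typicality. The support condition ensures that the information ratio is positive
  at every letter, as \<open>pmf_indep_eq\<close> requires.\<close>

definition typical :: "'t::finite pmf \<Rightarrow> real \<Rightarrow> 't list set" where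
  "typical T \<delta> = {ts. set ts \<subseteq> set_pmf T \<and> (\<forall>t. \<bar>emp ts t - pmf T t\<bar> \<le> \<delta>)}"

text \<open>The support condition holds almost surely; for the rest, Chebyshev is applied to the
  centred indicator of each letter and the failures are added by a union bound.\<close>

lemma prob_atypical_le:
  fixes T :: "'t::finite pmf"
  assumes "\<delta> > 0" "n > 0"
  shows "measure (measure_pmf (iid_pmf n T)) (- typical T \<delta>) \<le> CARD('t) / (n * \<delta>\<^sup>2)"
proof -
  define h where "h t a = of_bool (a = t) - pmf T t" for t a
  let ?B = "\<lambda>t. {ts. \<bar>\<Sum>a\<leftarrow>ts. h t a\<bar> > real n * \<delta>}"
  have h: "(\<Sum>a\<leftarrow>ts. h t a) = n * (emp ts t - pmf T t)" if "length ts = n" for ts t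
  proof -
    have "(\<Sum>a\<in>UNIV. emp ts a * of_bool (a = t)) = emp ts t"
      by (simp add: of_bool_def if_distrib[of "(*) _"] cong: if_cong)
    then have "emp ts t = (\<Sum>a\<leftarrow>ts. of_bool (a = t)) / length ts"
      by (simp add: sum_emp_eq)
    then show ?thesis
      using that assms by (simp add: h_def sum_list_subtractf sum_list_triv algebra_simps)
  qed
  have "measure (measure_pmf (iid_pmf n T)) (- typical T \<delta>) \<le> measure (measure_pmf (iid_pmf n T)) (\<Union>t. ?B t)"
  proof (rule measure_pmf.finite_measure_mono_AE)
    show "AE ts in measure_pmf (iid_pmf n T). ts \<in> - typical T \<delta> \<longrightarrow> ts \<in> (\<Union>t. ?B t)"
    proof (rule AE_pmfI, rule impI)
      fix ts assume ts: "ts \<in> set_pmf (iid_pmf n T)" "ts \<in> - typical T \<delta>"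
      then have len: "length ts = n" and "set ts \<subseteq> set_pmf T" using set_iid_pmf by blast+
      then obtain t where "\<bar>emp ts t - pmf T t\<bar> > \<delta>" using ts(2) by (auto simp: typical_def not_le)
      then have "\<bar>\<Sum>a\<leftarrow>ts. h t a\<bar> > real n * \<delta>"
        using assms by (simp add: h[OF len] abs_mult)
      then show "ts \<in> (\<Union>t. ?B t)" by blast
    qed
  qed simp
  also have "\<dots> \<le> (\<Sum>t\<in>UNIV. measure (measure_pmf (iid_pmf n T)) (?B t))"
    by (rule measure_pmf.finite_measure_subadditive_finite) auto
  also have "\<dots> \<le> (\<Sum>t\<in>(UNIV :: 't set). 1 / (n * \<delta>\<^sup>2))"
  proof (intro sum_mono prob_iid_deviation assms)
    fix t
    show "(\<Sum>a\<in>UNIV. pmf T a * h t a) = 0"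
      by (simp add: h_def right_diff_distrib sum_subtractf sum_distrib_right[symmetric] sum_pmf_UNIV
           of_bool_def if_distrib[of "(*) _"] cong: if_cong)
    show "\<bar>h t a\<bar> \<le> 1" for a using pmf_le_1[of T t] pmf_nonneg[of T t] unfolding h_def by (cases "a = t") (simp_all add: abs_le_iff)
  qed
  also have "\<dots> = CARD('t) / (n * \<delta>\<^sup>2)" by simp
  finally show ?thesis .
qed

lemma typical_sum_diff_le:
  fixes h :: "'t::finite \<Rightarrow> real"
  assumes "ts \<in> typical T \<delta>"
  shows "\<bar>(\<Sum>t\<in>UNIV. emp ts t * h t) - (\<Sum>t\<in>UNIV. pmf T t * h t)\<bar> \<le> \<delta> * (\<Sum>t\<in>UNIV. \<bar>h t\<bar>)"
proof -
  have "\<bar>(\<Sum>t\<in>UNIV. emp ts t * h t) - (\<Sum>t\<in>UNIV. pmf T t * h t)\<bar> = \<bar>\<Sum>t\<in>UNIV. (emp ts t - pmf T t) * h t\<bar>"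
    by (simp add: sum_subtractf left_diff_distrib)
  also have "\<dots> \<le> (\<Sum>t\<in>UNIV. \<bar>(emp ts t - pmf T t) * h t\<bar>)" by (rule sum_abs)
  also have "\<dots> \<le> (\<Sum>t\<in>UNIV. \<delta> * \<bar>h t\<bar>)"
    using assms by (intro sum_mono) (auto simp: abs_mult typical_def intro: mult_right_mono)
  finally show ?thesis by (simp add: sum_distrib_left)
qed

text \<open>\<open>Q z\<close> is the conditional law of the output given the side information, from
  which codewords are drawn. The identity is the form P(y | x, z) / P(y | z) of the ratio.\<close>

lemma ex_output_channel:
  fixes P :: "('x::finite \<times> 'z::finite) pmf"
  obtains Q where "\<And>x z y. 0 < pmf (channel_law P W) ((x, z), y) \<Longrightarrow>
     pmf (W x z) y = info_ratio P W ((x, z), y) * pmf (Q z) y"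
proof -
  let ?T = "pmf (channel_law P W)"
  define u where "u = (\<lambda>(z, y). \<Sum>x\<in>UNIV. ?T ((x, z), y))"
  have "0 \<le> u t" for t by (auto simp: u_def sum_nonneg split: prod.split)
  moreover have "(\<Sum>y\<in>UNIV. u (z, y)) = pmf (map_pmf snd P) z" for z
    unfolding u_def prod.case pmf_map_snd pmf_channel_law
    by (subst sum.swap) (simp add: sum_distrib_left[symmetric] sum_pmf_UNIV)
  ultimately obtain Q where Q: "\<And>t. pmf (joint_law (map_pmf snd P) Q) t = u t"
    using ex_joint_law by blast
  have "pmf (W x z) y = info_ratio P W ((x, z), y) * pmf (Q z) y" if pos: "0 < ?T ((x, z), y)" for x z y
  proof -
    have P: "pmf P (x, z) > 0" using pos by (simp add: pmf_channel_law zero_less_mult_iff)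
    let ?pz = "\<Sum>x'\<in>UNIV. pmf P (x', z)" and ?pzy = "\<Sum>x'\<in>UNIV. ?T ((x', z), y)"
    have "0 < ?pzy" by (rule sum_pos2[of _ x]) (use pos in auto)
    moreover have "?pz * pmf (Q z) y = ?pzy"
      using Q[of "(z, y)"] by (simp add: pmf_joint_law pmf_map_snd u_def)
    moreover have "info_ratio P W ((x, z), y) * pmf (Q z) y = pmf (W x z) y * (?pz * pmf (Q z) y) / ?pzy"
      using P by (simp add: info_ratio_def pmf_channel_law)
    ultimately show ?thesis by simp
  qed
  then show ?thesis using that by blast
qed

text \<open>Gibbs' inequality from \<open>ln r \<ge> 1 - 1 / r\<close>, against the law
  \<open>?T'\<close> whose output is drawn from \<open>Q z\<close> regardless of \<open>x\<close>.
  It guarantees at least one message at rate \<open>cond_mi P W + \<epsilon>\<close>.\<close>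

lemma cond_mi_nonneg: "0 \<le> cond_mi P W"
proof -
  obtain Q where Q: "\<And>x z y. 0 < pmf (channel_law P W) ((x, z), y) \<Longrightarrow>
     pmf (W x z) y = info_ratio P W ((x, z), y) * pmf (Q z) y"
    using ex_output_channel[of P W] by blast
  let ?T = "pmf (channel_law P W)" and ?T' = "pmf (channel_law P (\<lambda>x z. Q z))"
  have "?T t - ?T' t \<le> ?T t * ln (info_ratio P W t)" for t
  proof (cases "?T t = 0")
    case False
    then have pos: "0 < ?T t" using pmf_nonneg[of _ t] by (simp add: order_less_le)
    have r: "0 < info_ratio P W t" by (rule info_ratio_pos[OF pos])
    obtain x z y where t: "t = ((x, z), y)" by (metis surj_pair)
    have "?T t = info_ratio P W t * ?T' t"
      using Q[of x z y] pos by (simp add: t pmf_channel_law)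
    then have "?T t - ?T' t = ?T t * (1 - inverse (info_ratio P W t))"
      using r by (simp add: field_simps)
    also have "\<dots> \<le> ?T t * ln (info_ratio P W t)"
      using ln_le_minus_one[of "inverse (info_ratio P W t)"] r
      by (intro mult_left_mono) (auto simp: ln_inverse)
    finally show ?thesis .
  qed simp
  then have "(\<Sum>t\<in>UNIV. ?T t - ?T' t) \<le> (\<Sum>t\<in>UNIV. ?T t * ln (info_ratio P W t))"
    by (rule sum_mono)
  then have "0 \<le> (\<Sum>t\<in>UNIV. ?T t * ln (info_ratio P W t))"
    by (simp add: sum_subtractf sum_pmf_UNIV)
  then have "0 \<le> (\<Sum>t\<in>UNIV. ?T t * ln (info_ratio P W t)) / ln 2" by simp
  then show ?thesis by (simp add: cond_mi_eq log_def sum_divide_distrib)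
qed

text \<open>The change of measure from codewords to the true output. On typical pairs the exponent
  is close to \<open>n * cond_mi P W\<close>, which supplies the constant \<open>K\<close> of the
  covering lemmas.\<close>

lemma pmf_indep_eq:
  assumes Q: "\<And>x z y. 0 < pmf (channel_law P W) ((x, z), y) \<Longrightarrow>
     pmf (W x z) y = info_ratio P W ((x, z), y) * pmf (Q z) y"
  assumes "length xz = length ys" "set (zip xz ys) \<subseteq> set_pmf (channel_law P W)"
  shows "pmf (indep_pmf (\<lambda>a. W (fst a) (snd a)) xz) ys
    = 2 powr (\<Sum>t\<leftarrow>zip xz ys. log 2 (info_ratio P W t)) * pmf (indep_pmf Q (map snd xz)) ys"
  using assms(2,3)
proof (induction xz ys rule: list_induct2)
  case Nil
  then show ?case by simp
next
  case (Cons a xz y ys)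
  obtain x z where a: "a = (x, z)" by (metis surj_pair)
  have pos: "0 < pmf (channel_law P W) ((x, z), y)"
    using Cons.prems by (simp add: a pmf_positive)
  have "2 powr log 2 (info_ratio P W ((x, z), y)) = info_ratio P W ((x, z), y)"
    using info_ratio_pos[OF pos] by simp
  then show ?case
    using Cons Q[OF pos] by (simp add: pmf_indep_Cons a powr_add del: indep_pmf.simps)
qed

lemma sum_emp_UNIV:
  assumes "xs \<noteq> []"
  shows "(\<Sum>a\<in>UNIV. emp xs (a :: 'a::finite)) = 1"
  using sum_emp_eq[of xs "\<lambda>_. 1"] assms by (simp add: sum_list_triv)

lemma sum_emp_le:
  fixes h :: "'a::finite \<Rightarrow> real"
  assumes "xs \<noteq> []" "\<And>a. h a \<le> b"
  shows "(\<Sum>a\<in>UNIV. emp xs a * h a) \<le> b"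
proof -
  have "(\<Sum>a\<in>UNIV. emp xs a * h a) \<le> (\<Sum>a\<in>UNIV. emp xs a * b)"
    by (intro sum_mono mult_left_mono assms emp_nonneg)
  then show ?thesis by (simp add: sum_distrib_right[symmetric] sum_emp_UNIV assms)
qed

lemma abs_marginal_gap_le: "\<bar>marginal_gap A t\<bar> \<le> 1"
  by (simp add: marginal_gap_def)

lemma expectation_le_off_event:
  fixes F :: "'a \<Rightarrow> real"
  assumes "finite (set_pmf p)" "0 \<le> a" "0 \<le> b"
    and "\<And>x. x \<in> set_pmf p \<Longrightarrow> x \<notin> B \<Longrightarrow> F x \<le> a" "\<And>x. x \<in> set_pmf p \<Longrightarrow> F x \<le> b"
  shows "measure_pmf.expectation p F \<le> a + b * measure (measure_pmf p) B"
proof -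
  have "measure_pmf.expectation p F \<le> measure_pmf.expectation p (\<lambda>x. a + b * indicator B x)"
    using assms by (intro integral_mono_AE) (auto simp: integrable_measure_pmf_finite AE_measure_pmf_iff indicator_def intro: add_increasing)
  then show ?thesis using assms by (simp add: integrable_measure_pmf_finite)
qed

section \<open>From codebooks to achievability\<close>

text \<open>The encoder sends the index of a word that fits and the decoder looks it up. Both are
  deterministic and ignore the key, so the joint law is an image of the source law for every
  \<open>M0\<close>.\<close>

lemma codebook_code:
  fixes P :: "('x::finite \<times> 'z::finite) pmf" and c :: "'z list \<Rightarrow> 'x list list"
  assumes c: "\<And>zs. length (c zs) = nat \<lfloor>2 powr (real n * R)\<rfloor>" and M: "0 < nat \<lfloor>2 powr (real n * R)\<rfloor>"
  obtains f g y where "is_code n R R0 f g"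
    "\<And>M0. code_joint n P M0 f g = map_pmf (\<lambda>xz. (map fst xz, y xz)) (iid_pmf n P)"
    "\<And>xz. length (y xz) = n"
    "\<And>xz. \<exists>ys\<in>set (c (map snd xz)). length ys = n \<and> zip xz ys \<in> G \<Longrightarrow> zip xz (y xz) \<in> G"
proof -
  define M where "M = nat \<lfloor>2 powr (real n * R)\<rfloor>"
  \<comment> \<open>Messages start at 1 and list positions at 0. \<open>is_code\<close> demands
    output length \<open>n\<close> for every message, so a word of another length is replaced by a
    filler.\<close>
  define cw where "cw zs m = (let ys = c zs ! (m - 1) in if length ys = n then ys else replicate n undefined)" for zs m
  define good where "good xz m \<longleftrightarrow> m \<in> {1..M} \<and> zip xz (cw (map snd xz) m) \<in> G" for xz m
  \<comment> \<open>If no word fits, message 1 is sent, which exists because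
    \<open>M > 0\<close>.\<close>
  define idx where "idx xz = (if \<exists>m. good xz m then SOME m. good xz m else 1)" for xz
  define f where "f xs zs (k :: nat) = return_pmf (idx (zip xs zs))" for xs :: "'x list" and zs k
  define g where "g m zs (k :: nat) = return_pmf (cw zs m)" for m zs k
  have good_idx: "good xz (idx xz)" if "good xz m" for xz m
    using that someI[of "good xz"] by (auto simp: idx_def)
  have idx: "idx xz \<in> {1..M}" for xz
  proof (cases "\<exists>m. good xz m")
    case True
    then show ?thesis using good_idx good_def by blast
  next
    case False
    moreover have "1 \<le> M" using M unfolding M_def by linarith
    ultimately show ?thesis by (simp add: idx_def)
  qed
  have cw: "length (cw zs m) = n" for zs m by (simp add: cw_def Let_def)
  have 1: "is_code n R R0 f g"
    using idx cw by (auto simp: is_code_def f_def g_def idx_set_def M_def)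
  have 2: "code_joint n P M0 f g = map_pmf (\<lambda>xz. (map fst xz, cw (map snd xz) (idx xz))) (iid_pmf n P)" for M0
    by (simp add: code_joint_def f_def g_def bind_return_pmf map_pmf_def zip_map_fst_snd)
  have 3: "zip xz (cw (map snd xz) (idx xz)) \<in> G"
    if ex: "\<exists>ys\<in>set (c (map snd xz)). length ys = n \<and> zip xz ys \<in> G" for xz
  proof -
    obtain i where i: "i < M" "length (c (map snd xz) ! i) = n" "zip xz (c (map snd xz) ! i) \<in> G"
      using ex by (auto simp: in_set_conv_nth c M_def)
    then have "good xz (Suc i)" by (simp add: good_def cw_def)
    then show ?thesis using good_idx good_def by blast
  qed
  show ?thesis by (rule that[OF 1 2 cw 3])
qed

text \<open>The domination constant \<open>K\<close> has exponent
  \<open>n * (I + \<epsilon> / 2)\<close> and the codebook size exponent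
  \<open>n * (I + \<epsilon>)\<close>, with \<open>I = cond_mi P W\<close>. Thus
  \<open>M / K\<close> grows without bound and covering fails with vanishing probability.\<close>

theorem achievable_cond_mi:
  fixes P :: "('x::finite \<times> 'z::finite) pmf"
  assumes D: "\<And>a b. 0 \<le> D a b" "\<And>a b. D a b \<le> dmax"
    and W: "exp_dist P W D \<le> Dc" "dtv (PX P) (PY P W) \<le> Pc"
  shows "achievable_e P D (cond_mi P W) 0 Dc Pc"
  unfolding achievable_e_def
proof (intro allI impI)
  fix \<epsilon> :: real assume \<epsilon>: "\<epsilon> > 0"
  let ?T = "channel_law P W" and ?I = "cond_mi P W"
  let ?\<iota> = "\<lambda>t. log 2 (info_ratio P W t)"
  let ?D = "\<lambda>t :: ('x \<times> 'z) \<times> 'x. D (fst (fst t)) (snd t)"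
  obtain Q where Q: "\<And>x z y. 0 < pmf ?T ((x, z), y) \<Longrightarrow>
     pmf (W x z) y = info_ratio P W ((x, z), y) * pmf (Q z) y"
    using ex_output_channel[of P W] by blast
  have dmax: "0 \<le> dmax" using D order_trans by blast
  have Dc: "0 \<le> Dc"
    by (rule order_trans[OF _ W(1)]) (auto simp: exp_dist_eq D(1) intro!: sum_nonneg)
  have Pc: "0 \<le> Pc" using W(2) unfolding dtv_marginals_le_iff using abs_ge_zero order_trans by blast
  have I: "0 \<le> ?I" by (rule cond_mi_nonneg)
  \<comment> \<open>Bounds the sums of absolute values of all functions tested on typical words:
    information density, distortion and, through the cardinality, each
    \<open>marginal_gap A\<close>. With this \<delta>, typicality moves each mean by at most
    \<open>\<epsilon> / 2\<close>.\<close>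
  define C where "C = 1 + (\<Sum>t\<in>UNIV. \<bar>?\<iota> t\<bar>) + (\<Sum>t\<in>UNIV. \<bar>?D t\<bar>) + CARD(('x \<times> 'z) \<times> 'x)"
  define \<delta> where "\<delta> = \<epsilon> / (2 * C)"
  have C: "1 \<le> C" "(\<Sum>t\<in>UNIV. \<bar>?\<iota> t\<bar>) \<le> C" "(\<Sum>t\<in>UNIV. \<bar>?D t\<bar>) \<le> C" "CARD(('x \<times> 'z) \<times> 'x) \<le> C"
    unfolding C_def by (smt (verit) abs_ge_zero of_nat_0_le_iff sum_nonneg)+
  have \<delta>: "\<delta> > 0" using \<epsilon> C(1) by (simp add: \<delta>_def)
  have \<delta>C: "\<delta> * s \<le> \<epsilon> / 2" if "s \<le> C" for s
    using mult_left_mono[OF that, of \<delta>] \<delta> C(1) by (simp add: \<delta>_def)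
  \<comment> \<open>\<open>c0 / n\<close> will bound the failure probability: the first summand
    comes from atypicality, the second from \<open>exp (- (M / K))\<close>. In \<open>N\<close> the
    factor \<open>dmax + 1\<close> covers the worst losses on failure, \<open>dmax\<close> in
    distortion and 1 in total variation.\<close>
  define c0 where "c0 = CARD(('x \<times> 'z) \<times> 'x) / \<delta>\<^sup>2 + 1 / (\<epsilon> / 2 * ln 2)"
  have c0: "0 \<le> c0" using \<epsilon> by (simp add: c0_def)
  define N where "N = Suc (nat \<lceil>c0 * (dmax + 1) / (\<epsilon> / 2)\<rceil>)"
  show "\<exists>N. \<forall>n\<ge>N. \<exists>f g. is_code n (?I + \<epsilon>) (0 + \<epsilon>) f g \<and>
      (let J = code_joint n P (nat \<lfloor>2 powr (real n * (0 + \<epsilon>))\<rfloor>) f g in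
         measure_pmf.expectation J (\<lambda>(xs, ys). dist_n D xs ys) \<le> Dc + \<epsilon> \<and>
         measure_pmf.expectation J (\<lambda>(xs, ys). dtv (emp xs) (emp ys)) \<le> Pc + \<epsilon>)"
  proof (intro exI[of _ N] allI impI)
    fix n assume n: "n \<ge> N"
    have n0: "n > 0" using n by (simp add: N_def)
    have "c0 * (dmax + 1) / (\<epsilon> / 2) \<le> n" using n unfolding N_def by linarith
    then have nbig: "c0 / n * (dmax + 1) \<le> \<epsilon> / 2" using n0 \<epsilon> by (simp add: field_simps)
    define M where "M = nat \<lfloor>2 powr (real n * (?I + \<epsilon>))\<rfloor>"
    define K where "K = 2 powr (real n * (?I + \<epsilon> / 2))"
    let ?G = "typical ?T \<delta>"
    have M1: "1 \<le> 2 powr (real n * (?I + \<epsilon>))" using I \<epsilon> by (intro ge_one_powr_ge_zero) auto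
    have K1: "1 \<le> K" unfolding K_def using I \<epsilon> by (intro ge_one_powr_ge_zero) auto
    have M: "0 < M" "2 powr (real n * (?I + \<epsilon>)) - 1 \<le> M"
      using M1 unfolding M_def by linarith+
    have dom: "pmf (indep_pmf (\<lambda>a. W (fst a) (snd a)) xz) ys \<le> K * pmf (indep_pmf Q (map snd xz)) ys"
      if "length xz = n" "length ys = n" "zip xz ys \<in> ?G" for xz ys
    proof -
      have "(\<Sum>t\<leftarrow>zip xz ys. ?\<iota> t) = n * (\<Sum>t\<in>UNIV. emp (zip xz ys) t * ?\<iota> t)"
        using that by (simp add: sum_list_emp)
      also have "(\<Sum>t\<in>UNIV. emp (zip xz ys) t * ?\<iota> t) \<le> ?I + \<epsilon> / 2"
        using typical_sum_diff_le[OF that(3), of ?\<iota>] \<delta>C[OF C(2)] unfolding cond_mi_eq by linarith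
      finally have "2 powr (\<Sum>t\<leftarrow>zip xz ys. ?\<iota> t) \<le> K"
        using n0 by (simp add: K_def mult_left_mono)
      then show ?thesis
        using that by (subst pmf_indep_eq[OF Q]) (auto simp: typical_def intro: mult_right_mono)
    qed
    obtain c where c: "\<And>zs. length (c zs) = M"
      "measure (measure_pmf (iid_pmf n P)) {xz. \<forall>ys\<in>set (c (map snd xz)). \<not> (length ys = n \<and> zip xz ys \<in> ?G)}
       \<le> measure (measure_pmf (iid_pmf n ?T)) (- ?G) + exp (- (M / K))"
      by (rule ex_covering_codebooks[where G = ?G and M = M and P = P and K = K and Q = Q, OF _ dom,
            folded channel_law_def[of P W]])
         (use K1 in auto)
    let ?E = "{xz. \<forall>ys\<in>set (c (map snd xz)). \<not> (length ys = n \<and> zip xz ys \<in> ?G)}"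
    \<comment> \<open>Decay of order \<open>1 / n\<close> matches the Chebyshev term, so the crude
      bounds \<open>exp s \<ge> 1 + s\<close> and \<open>exp s \<ge> s\<close> suffice.\<close>
    have "exp (- (M / K)) \<le> 1 / (n * (\<epsilon> / 2 * ln 2))"
    proof -
      have "n * (\<epsilon> / 2 * ln 2) + 1 \<le> exp (n * (\<epsilon> / 2 * ln 2))" using exp_ge_add_one_self by (simp add: add.commute)
      also have "\<dots> = 2 powr (real n * (?I + \<epsilon>)) / K"
        by (simp add: K_def powr_def exp_diff[symmetric] algebra_simps)
      also have "\<dots> \<le> (M + 1) / K" using M(2) K1 by (intro divide_right_mono) auto
      also have "\<dots> \<le> M / K + 1" using K1 by (simp add: field_simps)
      finally have "n * (\<epsilon> / 2 * ln 2) \<le> M / K" by simp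
      also have "\<dots> \<le> exp (M / K)" using exp_ge_add_one_self[of "M / K"] by linarith
      finally have "1 / exp (M / K) \<le> 1 / (n * (\<epsilon> / 2 * ln 2))"
        using n0 \<epsilon> by (intro divide_left_mono) auto
      then show ?thesis by (simp add: exp_minus inverse_eq_divide)
    qed
    then have "measure (measure_pmf (iid_pmf n P)) ?E \<le> c0 / n"
      using c(2) prob_atypical_le[OF \<delta> n0, of ?T] by (simp add: c0_def add_divide_distrib mult_ac)
    then have "measure (measure_pmf (iid_pmf n P)) ?E * (dmax + 1) \<le> c0 / n * (dmax + 1)"
      using dmax by (intro mult_right_mono) auto
    then have E: "measure (measure_pmf (iid_pmf n P)) ?E * (dmax + 1) \<le> \<epsilon> / 2" using nbig by linarith
    have E': "dmax * measure (measure_pmf (iid_pmf n P)) ?E \<le> \<epsilon> / 2" "1 * measure (measure_pmf (iid_pmf n P)) ?E \<le> \<epsilon> / 2"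
    proof -
      have "dmax * m \<le> \<epsilon> / 2 \<and> 1 * m \<le> \<epsilon> / 2" if "0 \<le> m" "m * (dmax + 1) \<le> \<epsilon> / 2" for m
      proof -
        have "m * (dmax + 1) = dmax * m + m" by (simp add: algebra_simps)
        with that mult_nonneg_nonneg[OF dmax that(1)] show ?thesis by linarith
      qed
      from this[OF measure_nonneg E]
      show "dmax * measure (measure_pmf (iid_pmf n P)) ?E \<le> \<epsilon> / 2" "1 * measure (measure_pmf (iid_pmf n P)) ?E \<le> \<epsilon> / 2"
        by blast+
    qed
    obtain f g y where fg: "is_code n (?I + \<epsilon>) (0 + \<epsilon>) f g"
      "\<And>M0. code_joint n P M0 f g = map_pmf (\<lambda>xz. (map fst xz, y xz)) (iid_pmf n P)"
      and y: "\<And>xz. length (y xz) = n"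
      "\<And>xz. \<exists>ys\<in>set (c (map snd xz)). length ys = n \<and> zip xz ys \<in> ?G \<Longrightarrow> zip xz (y xz) \<in> ?G"
      using codebook_code[of c n "?I + \<epsilon>" "0 + \<epsilon>" P ?G] c(1) M(1) unfolding M_def by blast
    have fin: "finite (set_pmf (iid_pmf n P))"
      by (rule finite_subset[OF _ finite_lists_of_length[of n]]) (use set_iid_pmf in auto)
    have len: "length xz = n" if "xz \<in> set_pmf (iid_pmf n P)" for xz
      using that set_iid_pmf by blast
    have ne: "zip xz (y xz) \<noteq> []" if "length xz = n" for xz
      using that y(1)[of xz] n0 by (cases xz; cases "y xz") auto
    have "measure_pmf.expectation (iid_pmf n P) (\<lambda>xz. dist_n D (map fst xz) (y xz))
        \<le> (Dc + \<epsilon> / 2) + dmax * measure (measure_pmf (iid_pmf n P)) ?E"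
    proof (rule expectation_le_off_event[OF fin])
      fix xz assume "xz \<in> set_pmf (iid_pmf n P)"
      then have l: "length xz = n" by (rule len)
      show "dist_n D (map fst xz) (y xz) \<le> dmax"
        unfolding dist_n_emp[OF y(1)[of xz, folded l]] by (rule sum_emp_le[OF ne[OF l]]) (rule D)
      assume "xz \<notin> ?E"
      then have "zip xz (y xz) \<in> ?G" using y(2) by blast
      then show "dist_n D (map fst xz) (y xz) \<le> Dc + \<epsilon> / 2"
        unfolding dist_n_emp[OF y(1)[of xz, folded l]]
        using typical_sum_diff_le[of "zip xz (y xz)" ?T \<delta> ?D] \<delta>C[OF C(3)] W(1)[unfolded exp_dist_eq]
        by linarith
    qed (use Dc \<epsilon> dmax in auto)
    moreover have "measure_pmf.expectation (iid_pmf n P) (\<lambda>xz. dtv (emp (map fst xz)) (emp (y xz)))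
        \<le> (Pc + \<epsilon> / 2) + 1 * measure (measure_pmf (iid_pmf n P)) ?E"
    proof (rule expectation_le_off_event[OF fin])
      fix xz assume "xz \<in> set_pmf (iid_pmf n P)"
      then have l: "length xz = n" by (rule len)
      have "(\<Sum>t\<in>UNIV. emp (zip xz (y xz)) t * marginal_gap A t) \<le> 1"
        "(\<Sum>t\<in>UNIV. emp (zip xz (y xz)) t * - marginal_gap A t) \<le> 1" for A
        by (rule sum_emp_le[OF ne[OF l]], simp add: marginal_gap_def)+
      then show "dtv (emp (map fst xz)) (emp (y xz)) \<le> 1"
        unfolding dtv_emp_le_iff[OF y(1)[of xz, folded l]] by (simp add: sum_negf abs_le_iff)
      assume "xz \<notin> ?E"
      then have G: "zip xz (y xz) \<in> ?G" using y(2) by blast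
      show "dtv (emp (map fst xz)) (emp (y xz)) \<le> Pc + \<epsilon> / 2"
        unfolding dtv_emp_le_iff[OF y(1)[of xz, folded l]]
      proof
        fix A
        have "(\<Sum>t\<in>(UNIV :: (('x \<times> 'z) \<times> 'x) set). \<bar>marginal_gap A t\<bar>)
            \<le> (\<Sum>t\<in>(UNIV :: (('x \<times> 'z) \<times> 'x) set). 1)"
          by (intro sum_mono abs_marginal_gap_le)
        also have "\<dots> \<le> C" using C(4) by simp
        finally have "\<delta> * (\<Sum>t\<in>(UNIV :: (('x \<times> 'z) \<times> 'x) set). \<bar>marginal_gap A t\<bar>) \<le> \<epsilon> / 2" by (rule \<delta>C)
        then show "\<bar>\<Sum>t\<in>UNIV. emp (zip xz (y xz)) t * marginal_gap A t\<bar> \<le> Pc + \<epsilon> / 2"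
          using typical_sum_diff_le[OF G, of "marginal_gap A"]
            W(2)[unfolded dtv_marginals_le_iff, rule_format, of A]
          by linarith
      qed
    qed (use Pc \<epsilon> in auto)
    ultimately show "\<exists>f g. is_code n (?I + \<epsilon>) (0 + \<epsilon>) f g \<and>
      (let J = code_joint n P (nat \<lfloor>2 powr (real n * (0 + \<epsilon>))\<rfloor>) f g in
         measure_pmf.expectation J (\<lambda>(xs, ys). dist_n D xs ys) \<le> Dc + \<epsilon> \<and>
         measure_pmf.expectation J (\<lambda>(xs, ys). dtv (emp xs) (emp ys)) \<le> Pc + \<epsilon>)"
      using fg(1) E' by (intro exI[of _ f] exI[of _ g]) (simp add: fg(2) Let_def)
  qed
qed

theorem theorem3:
  fixes P :: "('x::finite \<times> 'z::finite) pmf"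
    and D :: "'x \<Rightarrow> 'x \<Rightarrow> real"
    and dmax Dc Pc :: real
  assumes "\<forall>a b. 0 \<le> D a b \<and> D a b \<le> dmax"
  shows "R_e P D Dc Pc = R_info P D Dc Pc"
\<comment> \<open>Every admissible channel gives an achievable rate, and every achievable rate
  dominates the information of some admissible channel. In the infeasible case both index sets are
  empty and both infima infinite.\<close>
proof (rule antisym)
  show "R_e P D Dc Pc \<le> R_info P D Dc Pc"
    unfolding R_info_def
  proof (rule INF_greatest)
    fix W assume "W \<in> {W. exp_dist P W D \<le> Dc \<and> dtv (PX P) (PY P W) \<le> Pc}"
    then have "achievable_e P D (cond_mi P W) 0 Dc Pc"
      using assms by (intro achievable_cond_mi[where dmax = dmax]) auto
    then show "R_e P D Dc Pc \<le> ereal (cond_mi P W)"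
      unfolding R_e_def by (intro INF_lower) auto
  qed
  show "R_info P D Dc Pc \<le> R_e P D Dc Pc"
    unfolding R_e_def
  proof (rule INF_greatest)
    fix R assume "R \<in> {R. \<exists>R0\<ge>0. achievable_e P D R R0 Dc Pc}"
    then obtain W where W: "exp_dist P W D \<le> Dc" "dtv (PX P) (PY P W) \<le> Pc" "cond_mi P W \<le> R"
      using ex_channel_of_achievable by blast
    then have "R_info P D Dc Pc \<le> ereal (cond_mi P W)"
      unfolding R_info_def by (intro INF_lower) auto
    also have "\<dots> \<le> ereal R" using W(3) by simp
    finally show "R_info P D Dc Pc \<le> ereal R" .
  qed
qed

end
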